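(* Let $(R,\mathfrak m)$ be a Cohen--Macaulay local ring and let $J\subset R$ be a proper ideal. Let $S=R/J$ and let $t=\operatorname{depth} S$. Then the following conditions are equivalent. (I) $S$ is Cohen--Macaulay and $\operatorname{ht}(J)=0$. (II) $I^{\mathrm{sat}}S=(IS)^{\mathrm{sat}}$ holds for every ideal $I$ of $R$ that is generated by $t$ elements which form a regular sequence both on $R$ and on $S$.
   Context: Local rings are Noetherian. For an ideal $K$ of a local ring $(A,\mathfrak m_A)$, the saturation of $K$ is $K^{\mathrm{sat}}=\bigcup_{i\ge 1}(K:_A\mathfrak m_A^i)$; thus $I^{\mathrm{sat}}$ is computed in $R$ and $(IS)^{\mathrm{sat}}$ in $S$. $I^{\mathrm{sat}}S$ and $IS$ denote extensions of ideals along $R\to S$. By convention, an ideal generated by a regular sequence of length zero is the zero ideal. *)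

theory Defs
  imports "HOL-Algebra.Algebra" "HOL-Library.Extended_Nat"
begin

text \<open>Local rings are commutative and Noetherian throughout.\<close>

locale local_ring = noetherian_ring R + cring R for R (structure) +
  assumes unique_maximal: "\<exists>!M. maximalideal M R"

definition max_ideal :: "('a, 'b) ring_scheme \<Rightarrow> 'a set"
  where "max_ideal A = (THE M. maximalideal M A)"

lemma (in local_ring) max_ideal_is_maximal: "maximalideal (max_ideal R) R"
  unfolding max_ideal_def using unique_maximal by (rule theI')

definition ideal_colon :: "('a, 'b) ring_scheme \<Rightarrow> 'a set \<Rightarrow> 'a set \<Rightarrow> 'a set"
  where "ideal_colon A K L = {a \<in> carrier A. \<forall>b\<in>L. a \<otimes>\<^bsub>A\<^esub> b \<in> K}"

text \<open>Powers of ideals are powers in the multiplicative monoid of \<^const>\<open>ideals_set\<close>,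
  whose unit element is the whole ring.\<close>

definition saturation :: "('a, 'b) ring_scheme \<Rightarrow> 'a set \<Rightarrow> 'a set"
  where "saturation A K =
    (\<Union>i\<in>{1::nat..}. ideal_colon A K (max_ideal A [^]\<^bsub>ideals_set A\<^esub> i))"

definition ideal_extension ::
    "('a \<Rightarrow> 'c) \<Rightarrow> ('c, 'd) ring_scheme \<Rightarrow> 'a set \<Rightarrow> 'c set"
  where "ideal_extension h B I = genideal B (h ` I)"

text \<open>A sequence is regular on \<open>A\<close> if each member is a nonzerodivisor on the
  quotient of \<open>A\<close> by its predecessors (written with representatives in \<open>A\<close>) and the whole
  sequence generates a proper ideal.  If \<open>B\<close> is an \<open>A\<close>-algebra with structure map \<open>h\<close>, elements
  of \<open>A\<close> act on \<open>B\<close> as multiplication by their images, so that \<open>xs\<close> is regular on the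
  \<open>A\<close>-module \<open>B\<close> precisely if \<open>regular_sequence B (map h xs)\<close>.\<close>

definition regular_sequence :: "('a, 'b) ring_scheme \<Rightarrow> 'a list \<Rightarrow> bool"
  where "regular_sequence A xs \<longleftrightarrow>
    set xs \<subseteq> carrier A \<and>
    (\<forall>i<length xs. \<forall>a\<in>carrier A.
       xs ! i \<otimes>\<^bsub>A\<^esub> a \<in> genideal A (set (take i xs)) \<longrightarrow> a \<in> genideal A (set (take i xs))) \<and>
    genideal A (set xs) \<noteq> carrier A"

definition depth :: "('a, 'b) ring_scheme \<Rightarrow> enat"
  where "depth A =
    Sup {enat (length xs) | xs. set xs \<subseteq> max_ideal A \<and> regular_sequence A xs}"

definition prime_chain :: "('a, 'b) ring_scheme \<Rightarrow> nat \<Rightarrow> (nat \<Rightarrow> 'a set) \<Rightarrow> bool"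
  where "prime_chain A n P \<longleftrightarrow>
    (\<forall>i\<le>n. primeideal (P i) A) \<and> (\<forall>i<n. P i \<subset> P (Suc i))"

definition krull_dim :: "('a, 'b) ring_scheme \<Rightarrow> enat"
  where "krull_dim A = Sup {enat n | n. \<exists>P. prime_chain A n P}"

definition prime_height :: "('a, 'b) ring_scheme \<Rightarrow> 'a set \<Rightarrow> enat"
  where "prime_height A Q = Sup {enat n | n. \<exists>P. prime_chain A n P \<and> P n = Q}"

definition height :: "('a, 'b) ring_scheme \<Rightarrow> 'a set \<Rightarrow> enat"
  where "height A I = Inf {prime_height A Q | Q. primeideal Q A \<and> I \<subseteq> Q}"

locale cohen_macaulay_local_ring = local_ring +
  assumes depth_eq_dim: "depth R = krull_dim R"

end

theory Submission
  imports Defs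
begin

text \<open>
  Let \<open>t = depth S\<close> and \<open>d = depth R = dim R\<close>. A regular sequence of length \<open>n\<close> on \<open>R/K\<close> produces a
  chain of \<open>n + 1\<close> primes above \<open>K\<close>, because a nonzerodivisor lies in no minimal prime; hence
  \<open>t \<le> dim S \<le> d\<close>. The theorem says that the saturation condition detects \<open>t = d\<close>.

  If \<open>S\<close> is Cohen--Macaulay and \<open>J\<close> has height zero, then \<open>t = d\<close>: some minimal prime of \<open>R\<close> contains \<open>J\<close>;
  it consists of zero divisors, hence lies in an associated prime of \<open>R\<close>, and above an associated prime there is a chain of
  length \<open>depth R\<close> (\<open>regular_mod_prime_chain_above\<close>). An ideal \<open>I\<close> generated by a regular sequence of
  length \<open>d\<close> contains a power of the maximal ideal, so \<open>I\<close> and \<open>I S\<close> both have the unit ideal as their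
  saturation.

  Conversely, let \<open>I\<close> be generated by a sequence of length \<open>t\<close> that is regular on \<open>R\<close> and on \<open>S\<close>; one exists
  as \<open>t \<le> d\<close> (\<open>common_regular_sequence\<close>). Then \<open>S/I S\<close> has depth zero, so some nonzero element of it is
  annihilated by the maximal ideal, and \<open>I S\<close> is not saturated. If \<open>t < d\<close>, then \<open>R/I\<close> has positive depth,
  so \<open>I\<close> is saturated and the two saturations differ. Thus \<open>t = d\<close>, which forces \<open>dim S = d\<close>, and the first
  member of a chain of \<open>d + 1\<close> primes above \<open>J\<close> is a minimal prime of \<open>R\<close>.

  Both directions need that depth can be computed with any regular sequence. The key step is
  \<open>regular_mod_insert\<close>: dividing by an arbitrary nonzerodivisor of the maximal ideal lowers the depth by one.
  It rests on prime avoidance for the finitely many associated primes, on Nakayama's lemma, and on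
  \<open>socle_exchange\<close>. It also shows that the depth is finite, and with it the dimension of \<open>R\<close>. All
  arguments take place in one ring, relative to an ideal \<open>K\<close>; statements about \<open>R/K\<close> are recovered along the
  surjection \<open>R \<rightarrow> R/K\<close>.
\<close>

section \<open>Ideals of Noetherian rings\<close>

lemma (in noetherian_ring) ideal_maximal_element:
  assumes "F \<noteq> {}" and ideals: "\<And>I. I \<in> F \<Longrightarrow> ideal I R"
  obtains M where "M \<in> F" "\<And>L. L \<in> F \<Longrightarrow> M \<subseteq> L \<Longrightarrow> L = M"
proof -
  have "\<exists>M\<in>F. \<forall>L\<in>F. M \<subseteq> L \<longrightarrow> L = M"
  proof (rule subset_Zorn)
    fix C assume C: "subset.chain F C"
    show "\<exists>U\<in>F. \<forall>L\<in>C. L \<subseteq> U"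
    proof (cases "C = {}")
      case True
      then show ?thesis using assms(1) by blast
    next
      case False
      have "subset.chain {I. ideal I R} C"
        using C ideals unfolding pred_on.chain_def by blast
      then have "\<Union>C \<in> C"
        using ideal_chain_is_trivial False by blast
      then show ?thesis
        using C by (intro bexI[of _ "\<Union>C"]) (auto simp: pred_on.chain_def)
    qed
  qed
  then show ?thesis using that by blast
qed

lemma (in noetherian_ring) ideal_induct [consumes 1, case_names larger]:
  assumes "ideal K R"
    and step: "\<And>K. ideal K R \<Longrightarrow> (\<And>L. ideal L R \<Longrightarrow> K \<subset> L \<Longrightarrow> P L) \<Longrightarrow> P K"
  shows "P K"
proof (rule ccontr)
  assume "\<not> P K"
  then have "{L. ideal L R \<and> \<not> P L} \<noteq> {}"
    using assms(1) by blast
  then obtain M where M: "ideal M R" "\<not> P M"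
    and max: "\<And>L. ideal L R \<Longrightarrow> \<not> P L \<Longrightarrow> M \<subseteq> L \<Longrightarrow> L = M"
    by (rule ideal_maximal_element) auto
  have "P M"
    using step[OF M(1)] max by blast
  with M(2) show False ..
qed

lemma (in ring) Idl_Idl_Un:
  assumes "A \<subseteq> carrier R" "B \<subseteq> carrier R"
  shows "Idl (Idl A \<union> B) = Idl (A \<union> B)"
proof
  have AB: "ideal (Idl (A \<union> B)) R" and self: "A \<union> B \<subseteq> Idl (A \<union> B)"
    using assms genideal_ideal[of "A \<union> B"] genideal_self[of "A \<union> B"] by simp_all
  show "Idl (Idl A \<union> B) \<subseteq> Idl (A \<union> B)"
    using self by (intro genideal_minimal AB Un_least) auto
  have sub: "Idl A \<union> B \<subseteq> carrier R"
    using ideal.Icarr[OF genideal_ideal[OF assms(1)]] assms(2) by blast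
  show "Idl (A \<union> B) \<subseteq> Idl (Idl A \<union> B)"
    using genideal_self[OF sub] genideal_self[OF assms(1)]
    by (intro genideal_minimal genideal_ideal sub) blast
qed

lemma (in ring) ideal_subset_carrier: "ideal I R \<Longrightarrow> I \<subseteq> carrier R"
  by (rule additive_subgroup.a_subset[OF ideal.axioms(1)])

lemma (in ring) Idl_of_ideal: "ideal I R \<Longrightarrow> Idl I = I"
  by (intro subset_antisym genideal_minimal genideal_self ideal_subset_carrier order.refl)

lemma (in ring) Idl_insert_ideal:
  "ideal K R \<Longrightarrow> x \<in> carrier R \<Longrightarrow> ideal (Idl (insert x K)) R"
  by (simp add: genideal_ideal ideal_subset_carrier)

lemma (in ring) Idl_insert_self:
  "ideal K R \<Longrightarrow> x \<in> carrier R \<Longrightarrow> insert x K \<subseteq> Idl (insert x K)"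
  by (rule genideal_self) (simp add: ideal_subset_carrier)

lemma (in ring) Idl_insert_Un:
  assumes "ideal K R" "x \<in> carrier R" "B \<subseteq> carrier R"
  shows "Idl (Idl (insert x K) \<union> B) = Idl (K \<union> insert x B)"
  using Idl_Idl_Un[of "insert x K" B] assms ideal_subset_carrier[OF assms(1)] by simp

lemma (in ring) Idl_insert_commute:
  assumes "ideal K R" "x \<in> carrier R" "y \<in> carrier R"
  shows "Idl (insert y (Idl (insert x K))) = Idl (insert x (Idl (insert y K)))"
  using Idl_insert_Un[of K x "{y}"] Idl_insert_Un[of K y "{x}"] assms
  by (simp add: insert_commute)

lemma (in cring) mem_Idl_insert_iff:
  assumes "ideal K R" "x \<in> carrier R"
  shows "a \<in> Idl (insert x K) \<longleftrightarrow> (\<exists>k\<in>K. \<exists>r\<in>carrier R. a = k \<oplus> r \<otimes> x)"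
proof -
  have "Idl (insert x K) = Idl ({x} \<union> K)"
    by simp
  also have "\<dots> = Idl (Idl {x} \<union> K)"
    using assms ideal_subset_carrier by (subst Idl_Idl_Un) auto
  also have "\<dots> = K <+> PIdl x"
    using union_genideal[OF assms(1) cgenideal_ideal[OF assms(2)]]
    by (simp add: cgenideal_eq_genideal[OF assms(2)] Un_commute)
  finally show ?thesis
    by (auto simp: set_add_def' cgenideal_def)
qed

section \<open>Colon ideals, prime ideals and associated primes\<close>

lemma mem_ideal_colon_singleton:
  "r \<in> ideal_colon A K {a} \<longleftrightarrow> r \<in> carrier A \<and> r \<otimes>\<^bsub>A\<^esub> a \<in> K"
  by (simp add: ideal_colon_def)

lemma (in cring) ideal_colon_is_ideal:
  assumes "ideal K R" "L \<subseteq> carrier R"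
  shows "ideal (ideal_colon R K L) R"
proof -
  interpret K: ideal K R by fact
  have L: "b \<in> carrier R" if "b \<in> L" for b
    using assms(2) that by blast
  show ?thesis
    unfolding ideal_colon_def
  proof (rule idealI[OF ring_axioms])
    show "subgroup {a \<in> carrier R. \<forall>b\<in>L. a \<otimes> b \<in> K} (add_monoid R)"
      by (rule subgroup.intro)
        (auto simp: l_distr l_minus L simp flip: a_inv_def)
    fix a x assume a: "a \<in> {a \<in> carrier R. \<forall>b\<in>L. a \<otimes> b \<in> K}" and x: "x \<in> carrier R"
    then show "x \<otimes> a \<in> {a \<in> carrier R. \<forall>b\<in>L. a \<otimes> b \<in> K}"
      by (auto simp: m_assoc L K.I_l_closed)
    then show "a \<otimes> x \<in> {a \<in> carrier R. \<forall>b\<in>L. a \<otimes> b \<in> K}"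
      using a x by (simp add: m_comm)
  qed
qed

lemma (in cring) ideal_colon_mult_subset:
  assumes "ideal K R" "a \<in> carrier R" "s \<in> carrier R"
  shows "ideal_colon R K {a} \<subseteq> ideal_colon R K {s \<otimes> a}"
proof
  fix x assume "x \<in> ideal_colon R K {a}"
  then have x: "x \<in> carrier R" "x \<otimes> a \<in> K"
    by (simp_all add: mem_ideal_colon_singleton)
  then have "s \<otimes> (x \<otimes> a) \<in> K"
    using assms ideal.I_l_closed[OF assms(1)] by simp
  then show "x \<in> ideal_colon R K {s \<otimes> a}"
    using x assms m_lcomm[of x s a] by (simp add: mem_ideal_colon_singleton)
qed

lemma (in cring) ideal_colon_eq_carrier_iff:
  assumes "ideal K R" "a \<in> carrier R"
  shows "ideal_colon R K {a} = carrier R \<longleftrightarrow> a \<in> K"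
proof
  assume "ideal_colon R K {a} = carrier R"
  then have "\<one> \<in> ideal_colon R K {a}" by simp
  then show "a \<in> K" using assms by (simp add: mem_ideal_colon_singleton)
qed (use assms ideal.I_l_closed in \<open>auto simp: mem_ideal_colon_singleton\<close>)

definition associated_primes :: "('a, 'b) ring_scheme \<Rightarrow> 'a set \<Rightarrow> 'a set set"
  where "associated_primes A K =
    {P. primeideal P A \<and> (\<exists>a\<in>carrier A. P = ideal_colon A K {a})}"

text \<open>A member of the family of colon ideals \<open>(K : b)\<close> that is maximal is prime: if
  \<open>u v b \<in> K\<close> and \<open>u b \<notin> K\<close>, then \<open>(K : b)\<close> equals the colon ideal \<open>(K : u b)\<close>, which
  contains \<open>v\<close>.\<close>

lemma (in local_ring) colon_subset_associated_prime:
  assumes "ideal K R" "a \<in> carrier R" "a \<notin> K"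
  obtains P where "P \<in> associated_primes R K" "ideal_colon R K {a} \<subseteq> P"
proof -
  let ?F = "{ideal_colon R K {b} | b. b \<in> carrier R \<and> b \<notin> K \<and>
    ideal_colon R K {a} \<subseteq> ideal_colon R K {b}}"
  have "?F \<noteq> {}" using assms by blast
  then obtain M where "M \<in> ?F" and max: "\<And>L. L \<in> ?F \<Longrightarrow> M \<subseteq> L \<Longrightarrow> L = M"
    by (rule ideal_maximal_element) (auto intro: ideal_colon_is_ideal assms)
  then obtain b where b: "M = ideal_colon R K {b}" "b \<in> carrier R" "b \<notin> K"
    and aM: "ideal_colon R K {a} \<subseteq> M" by blast
  have "primeideal M R"
  proof (rule primeidealI)
    show "ideal M R"
      using b assms by (simp add: ideal_colon_is_ideal)
    show "cring R" by (rule is_cring)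
    show "carrier R \<noteq> M"
      using b ideal_colon_eq_carrier_iff[OF assms(1)] by metis
    fix u v assume uv: "u \<in> carrier R" "v \<in> carrier R" "u \<otimes> v \<in> M"
    show "u \<in> M \<or> v \<in> M"
    proof (cases "u \<otimes> b \<in> K")
      case True
      then show ?thesis using uv b by (simp add: mem_ideal_colon_singleton)
    next
      case False
      have "M \<subseteq> ideal_colon R K {u \<otimes> b}"
        using ideal_colon_mult_subset[OF assms(1)] b uv by simp
      with False have "ideal_colon R K {u \<otimes> b} = M"
        using uv b aM by (intro max) auto
      moreover have "v \<in> ideal_colon R K {u \<otimes> b}"
        using uv b by (simp add: mem_ideal_colon_singleton m_ac)
      ultimately show ?thesis by simp
    qed
  qed
  then have "M \<in> associated_primes R K"
    unfolding associated_primes_def using b by blast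
  then show ?thesis using aM that by blast
qed

text \<open>The finiteness of the set of associated primes comes from the extension
  \<open>0 \<rightarrow> R/P \<rightarrow> R/K \<rightarrow> R/(K + R c) \<rightarrow> 0\<close> for an associated prime \<open>P = (K : c)\<close>: an
  associated prime of \<open>K\<close> other than \<open>P\<close> is associated to the larger ideal \<open>K + R c\<close>.\<close>

lemma (in local_ring) finite_associated_primes:
  assumes "ideal K R"
  shows "finite (associated_primes R K)"
  using assms
proof (induction rule: ideal_induct)
  case (larger K)
  note K = \<open>ideal K R\<close>
  interpret K: ideal K R by (rule K)
  show ?case
  proof (cases "\<one> \<in> K")
    case True
    then have "K = carrier R"
      by (rule K.one_imp_carrier)
    then have "associated_primes R K = {}"
      using ideal_colon_eq_carrier_iff[OF K] primeideal.I_notcarr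
      unfolding associated_primes_def by blast
    then show ?thesis by simp
  next
    case False
    then obtain P where "P \<in> associated_primes R K"
      using colon_subset_associated_prime[OF K one_closed] by blast
    then obtain c where P: "primeideal P R" and c: "c \<in> carrier R" "P = ideal_colon R K {c}"
      unfolding associated_primes_def by blast
    interpret P: primeideal P R by (rule P)
    define L where "L = Idl (insert c K)"
    have L: "ideal L R"
      unfolding L_def using K c by (intro Idl_insert_ideal)
    have "c \<notin> K"
      using c ideal_colon_eq_carrier_iff[OF K] P.I_notcarr by metis
    then have KL: "K \<subset> L"
      unfolding L_def using Idl_insert_self[OF K c(1)] by blast
    have "associated_primes R K \<subseteq> insert P (associated_primes R L)"
    proof
      fix Q assume "Q \<in> associated_primes R K"
      then obtain a where Q: "primeideal Q R" and a: "a \<in> carrier R" "Q = ideal_colon R K {a}"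
        unfolding associated_primes_def by blast
      interpret Q: primeideal Q R by (rule Q)
      show "Q \<in> insert P (associated_primes R L)"
      proof (cases "ideal_colon R L {a} \<subseteq> Q")
        case True
        have "Q \<subseteq> ideal_colon R L {a}"
          using KL unfolding a(2) ideal_colon_def by blast
        with True have "Q = ideal_colon R L {a}" by blast
        then show ?thesis
          using Q a unfolding associated_primes_def by blast
      next
        case False
        then obtain r where r: "r \<in> carrier R" "r \<otimes> a \<in> L" "r \<notin> Q"
          unfolding subset_iff mem_ideal_colon_singleton by blast
        then obtain k u where u: "k \<in> K" "u \<in> carrier R" "r \<otimes> a = k \<oplus> u \<otimes> c"
          unfolding L_def using mem_Idl_insert_iff[OF K c(1)] by blast
        have k: "k \<in> carrier R" using u K.Icarr by blast
        \<comment> \<open>The multiple \<open>r a\<close> of \<open>a\<close> is nonzero modulo \<open>K\<close> and agrees there with a multiple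
          of \<open>c\<close>, so its annihilator is both \<open>Q\<close> and \<open>P\<close>.\<close>
        have key: "s \<in> Q \<longleftrightarrow> s \<otimes> u \<in> P" if s: "s \<in> carrier R" for s
        proof -
          have "s \<in> Q \<longleftrightarrow> s \<otimes> r \<in> Q"
            using Q.I_prime[OF s r(1)] r(1,3) Q.I_r_closed by blast
          also have "\<dots> \<longleftrightarrow> s \<otimes> (k \<oplus> u \<otimes> c) \<in> K"
            using s r a(1) u(3) by (simp add: a(2) mem_ideal_colon_singleton m_assoc)
          also have "s \<otimes> (k \<oplus> u \<otimes> c) = s \<otimes> k \<oplus> (s \<otimes> u) \<otimes> c"
            using s k u c by (simp add: r_distr m_assoc)
          also have "\<dots> \<in> K \<longleftrightarrow> (s \<otimes> u) \<otimes> c \<in> K"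
          proof -
            have sk: "s \<otimes> k \<in> K" using s u K.I_l_closed by blast
            have "(s \<otimes> u) \<otimes> c = \<ominus> (s \<otimes> k) \<oplus> (s \<otimes> k \<oplus> (s \<otimes> u) \<otimes> c)"
              using s k u c by algebra
            then show ?thesis using sk K.a_closed K.a_inv_closed by metis
          qed
          also have "\<dots> \<longleftrightarrow> s \<otimes> u \<in> P"
            using s u c by (simp add: mem_ideal_colon_singleton)
          finally show ?thesis .
        qed
        have "u \<notin> P"
          using key[of \<one>] Q.one_imp_carrier Q.I_notcarr u by auto
        then have "s \<in> Q \<longleftrightarrow> s \<in> P" if "s \<in> carrier R" for s
          using key[OF that] P.I_prime[OF that u(2)] P.I_r_closed u(2) by blast
        then have "Q = P"
          using P.Icarr Q.Icarr by blast
        then show ?thesis by blast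
      qed
    qed
    moreover have "finite (associated_primes R L)"
      by (rule larger.IH[OF L KL])
    ultimately show ?thesis
      using finite_subset by blast
  qed
qed

text \<open>In a minimal counterexample every prime \<open>P\<close> of the family contains an element \<open>x\<^sub>P\<close> of \<open>L\<close>
  that the other members avoid. For any one \<open>P\<close>, the sum of \<open>x\<^sub>P\<close> and the product of the \<open>x\<^sub>Q\<close> for the
  other members \<open>Q\<close> is an element of \<open>L\<close> outside the union.\<close>

lemma (in cring) prime_avoidance:
  assumes "finite F" and "\<And>P. P \<in> F \<Longrightarrow> primeideal P R" and "ideal L R" and "L \<subseteq> \<Union>F"
  shows "\<exists>P\<in>F. L \<subseteq> P"
  using assms(1,2,4)
proof (induction "card F" arbitrary: F rule: less_induct)
  case less
  interpret L: ideal L R by fact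
  show ?case
  proof (rule ccontr)
    assume neg: "\<not> (\<exists>P\<in>F. L \<subseteq> P)"
    have "\<exists>x\<in>L. x \<in> P \<and> (\<forall>Q\<in>F - {P}. x \<notin> Q)" if P: "P \<in> F" for P
    proof -
      have "\<not> L \<subseteq> \<Union>(F - {P})"
        using less.hyps[of "F - {P}"] less.prems(1,2) neg P card_Diff1_less[OF less.prems(1) P] by blast
      then show ?thesis using less.prems(3) by blast
    qed
    then obtain x where x: "\<And>P. P \<in> F \<Longrightarrow> x P \<in> L \<and> x P \<in> P \<and> (\<forall>Q\<in>F - {P}. x P \<notin> Q)"
      by metis
    have xc: "x P \<in> carrier R" if "P \<in> F" for P
      using x[OF that] L.Icarr by blast
    have "\<zero> \<in> L" by simp
    then obtain P where P: "P \<in> F" using less.prems(3) by blast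
    interpret P: primeideal P R using less.prems(2) P by blast
    have "F - {P} \<noteq> {}"
      using neg P less.prems(3) by fastforce
    define y where "y = finprod R x (F - {P})"
    have fin: "finite (F - {P})" using less.prems(1) by simp
    have yprops: "finprod R x G \<in> carrier R \<and> finprod R x G \<notin> P \<and>
        (\<forall>Q\<in>G. finprod R x G \<in> Q) \<and> (G \<noteq> {} \<longrightarrow> finprod R x G \<in> L)"
      if "finite G" "G \<subseteq> F - {P}" for G
      using that
    proof (induction G rule: finite_induct)
      case empty
      then show ?case using P.one_imp_carrier P.I_notcarr by auto
    next
      case (insert Q G)
      have Q: "Q \<in> F" "Q \<noteq> P" and G: "G \<subseteq> F" using insert.prems by auto
      interpret Q: primeideal Q R using less.prems(2) Q by blast
      have eq: "finprod R x (insert Q G) = x Q \<otimes> finprod R x G"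
        using insert xc Q G by (intro finprod_insert) auto
      have IH: "finprod R x G \<in> carrier R" "finprod R x G \<notin> P" "\<forall>Q\<in>G. finprod R x G \<in> Q"
        using insert by auto
      have nP: "x Q \<otimes> finprod R x G \<notin> P"
        using P.I_prime[OF xc[OF Q(1)] IH(1)] IH(2) x[OF Q(1)] P Q(2) by blast
      have "x Q \<otimes> finprod R x G \<in> Q'" if "Q' \<in> insert Q G" for Q'
      proof -
        interpret Q': primeideal Q' R using less.prems(2) that Q G by blast
        show ?thesis
        proof (cases "Q' = Q")
          case True
          then show ?thesis using x[OF Q(1)] IH(1) Q'.I_r_closed by blast
        next
          case False
          then show ?thesis using that IH(3) xc[OF Q(1)] Q'.I_l_closed by blast
        qed
      qed
      moreover have "x Q \<otimes> finprod R x G \<in> L"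
        using x[OF Q(1)] IH(1) L.I_r_closed by blast
      ultimately show ?case
        unfolding eq using nP IH(1) xc[OF Q(1)] by auto
    qed
    have y: "y \<in> carrier R" "y \<notin> P" "\<And>Q. Q \<in> F - {P} \<Longrightarrow> y \<in> Q" "y \<in> L"
      unfolding y_def using yprops[OF fin order.refl] \<open>F - {P} \<noteq> {}\<close> by auto
    have z: "x P \<oplus> y \<in> L"
      using x[OF P] y(4) by simp
    then obtain Q where Q: "Q \<in> F" "x P \<oplus> y \<in> Q"
      using less.prems(3) by blast
    interpret Q: primeideal Q R using less.prems(2) Q by blast
    have e1: "y = \<ominus> (x P) \<oplus> (x P \<oplus> y)" and e2: "x P = (x P \<oplus> y) \<oplus> \<ominus> y"
      using xc[OF P] y(1) by algebra+
    show False
    proof (cases "Q = P")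
      case True
      have "\<ominus> (x P) \<in> P"
        using x[OF P] by (intro P.a_inv_closed) blast
      then have "y \<in> P"
        using Q(2) True P.a_closed e1 by metis
      with y(2) show False ..
    next
      case False
      then have "\<ominus> y \<in> Q"
        using y(3) Q(1) by (intro Q.a_inv_closed) blast
      then have "x P \<in> Q"
        using Q(2) Q.a_closed e2 by metis
      then show False using x[OF P] Q(1) False by blast
    qed
  qed
qed

section \<open>The maximal ideal of a local ring\<close>

lemma (in noetherian_ring) proper_ideal_subset_maximalideal:
  assumes "ideal K R" "K \<noteq> carrier R"
  obtains M where "maximalideal M R" "K \<subseteq> M"
proof -
  let ?F = "{L. ideal L R \<and> K \<subseteq> L \<and> L \<noteq> carrier R}"
  have "?F \<noteq> {}" using assms by blast
  then obtain M where M: "M \<in> ?F" and max: "\<And>L. L \<in> ?F \<Longrightarrow> M \<subseteq> L \<Longrightarrow> L = M"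
    by (rule ideal_maximal_element) auto
  have "maximalideal M R"
    using M max by (intro maximalidealI) blast+
  then show ?thesis using M that by blast
qed

lemma (in local_ring) maximalideal_eq_max_ideal: "maximalideal M R \<Longrightarrow> M = max_ideal R"
  using unique_maximal max_ideal_is_maximal by blast

lemma (in local_ring) proper_ideal_subset_max_ideal:
  assumes "ideal K R" "K \<noteq> carrier R"
  shows "K \<subseteq> max_ideal R"
  using proper_ideal_subset_maximalideal[OF assms] maximalideal_eq_max_ideal by metis

lemma (in local_ring) max_ideal_prime: "primeideal (max_ideal R) R"
  by (rule maximalideal_prime[OF max_ideal_is_maximal])

lemma (in local_ring) max_ideal_ideal: "ideal (max_ideal R) R"
  using max_ideal_prime primeideal.axioms(1) by blast

lemma (in local_ring) max_ideal_carrier: "x \<in> max_ideal R \<Longrightarrow> x \<in> carrier R"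
  by (rule ideal.Icarr[OF max_ideal_ideal])

lemma (in local_ring) one_notin_max_ideal: "\<one> \<notin> max_ideal R"
  using ideal.one_imp_carrier[OF max_ideal_ideal] primeideal.I_notcarr[OF max_ideal_prime] by blast

lemma (in local_ring) invertible_outside_max_ideal:
  assumes "u \<in> carrier R" "u \<notin> max_ideal R"
  obtains v where "v \<in> carrier R" "v \<otimes> u = \<one>"
proof -
  have "PIdl u = carrier R"
    using proper_ideal_subset_max_ideal[OF cgenideal_ideal[OF assms(1)]]
      cgenideal_self[OF assms(1)] assms(2) by blast
  then have "\<one> \<in> PIdl u" by simp
  then show ?thesis
    using that unfolding cgenideal_def by auto
qed

lemma (in local_ring) cancel_one_minus:
  assumes "ideal K R" and x: "x \<in> max_ideal R" and s: "s \<in> carrier R" and a: "a \<in> carrier R"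
    and K: "a \<ominus> s \<otimes> x \<otimes> a \<in> K"
  shows "a \<in> K"
proof -
  interpret M: ideal "max_ideal R" R by (rule max_ideal_ideal)
  have xc: "x \<in> carrier R" using x M.Icarr by simp
  have sx: "s \<otimes> x \<in> max_ideal R"
    using x s M.I_l_closed by simp
  have "\<one> \<ominus> s \<otimes> x \<notin> max_ideal R"
  proof
    assume "\<one> \<ominus> s \<otimes> x \<in> max_ideal R"
    then have "(\<one> \<ominus> s \<otimes> x) \<oplus> s \<otimes> x \<in> max_ideal R"
      using sx by (rule M.a_closed)
    moreover have "(\<one> \<ominus> s \<otimes> x) \<oplus> s \<otimes> x = \<one>"
      using s xc by algebra
    ultimately show False using one_notin_max_ideal by simp
  qed
  then obtain v where v: "v \<in> carrier R" "v \<otimes> (\<one> \<ominus> s \<otimes> x) = \<one>"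
    using invertible_outside_max_ideal[of "\<one> \<ominus> s \<otimes> x"] s xc by auto
  have "v \<otimes> (a \<ominus> s \<otimes> x \<otimes> a) = (v \<otimes> (\<one> \<ominus> s \<otimes> x)) \<otimes> a"
    using v(1) s xc a by algebra
  also have "\<dots> = a"
    using v(2) a by simp
  finally show ?thesis
    using ideal.I_l_closed[OF assms(1) K v(1)] by simp
qed

text \<open>Nakayama's lemma for multiplication by one element. For \<open>b \<in> N\<close>, take \<open>K + R a\<close> maximal
  among the ideals of this form, with \<open>a \<in> N\<close>, that contain \<open>b\<close>. Since \<open>a\<close> lies in \<open>K + R r\<close>, where
  \<open>a \<equiv> r x\<close>, maximality gives \<open>r \<in> K + R a\<close>, so \<open>(1 - s x) a \<in> K\<close> for some \<open>s\<close>, and the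
  factor \<open>1 - s x\<close> is invertible.\<close>

lemma (in local_ring) nakayama_single:
  assumes K: "ideal K R" and N: "ideal N R" and x: "x \<in> max_ideal R"
    and N_le: "\<And>a. a \<in> N \<Longrightarrow> \<exists>k\<in>K. \<exists>r\<in>N. a = k \<oplus> r \<otimes> x"
  shows "N \<subseteq> K"
proof
  interpret K: ideal K R by (rule K)
  interpret N: ideal N R by (rule N)
  have xc: "x \<in> carrier R" using x by (rule max_ideal_carrier)
  fix b assume b: "b \<in> N"
  let ?F = "{Idl (insert a K) | a. a \<in> N \<and> b \<in> Idl (insert a K)}"
  have "?F \<noteq> {}"
    using b Idl_insert_self[OF K N.Icarr[OF b]] by blast
  then obtain M where "M \<in> ?F" and max: "\<And>L. L \<in> ?F \<Longrightarrow> M \<subseteq> L \<Longrightarrow> L = M"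
    by (rule ideal_maximal_element) (auto intro: Idl_insert_ideal K N.Icarr)
  then obtain a where a: "a \<in> N" "b \<in> M" "M = Idl (insert a K)" by blast
  obtain k r where kr: "k \<in> K" "r \<in> N" "a = k \<oplus> r \<otimes> x"
    using N_le[OF a(1)] by blast
  have c: "a \<in> carrier R" "k \<in> carrier R" "r \<in> carrier R"
    using a kr K.Icarr N.Icarr by simp_all
  note idr = Idl_insert_ideal[OF K c(3)] and selfr = Idl_insert_self[OF K c(3)]
  have "a \<in> Idl (insert r K)"
    unfolding mem_Idl_insert_iff[OF K c(3)] using kr(1,3) xc c(3) m_comm by metis
  then have sub: "M \<subseteq> Idl (insert r K)"
    unfolding a(3) using selfr by (intro genideal_minimal idr) blast
  then have "Idl (insert r K) = M"
    using a(2) kr(2) by (intro max) auto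
  then have "r \<in> Idl (insert a K)"
    using selfr a(3) by blast
  then obtain k' s where s: "k' \<in> K" "s \<in> carrier R" "r = k' \<oplus> s \<otimes> a"
    using mem_Idl_insert_iff[OF K c(1)] by blast
  have k'c: "k' \<in> carrier R" using s K.Icarr by simp
  have "a \<ominus> s \<otimes> x \<otimes> a = (k \<oplus> (k' \<oplus> s \<otimes> a) \<otimes> x) \<ominus> s \<otimes> x \<otimes> a"
    using kr(3) s(3) by simp
  also have "\<dots> = k \<oplus> k' \<otimes> x"
    using c(1,2) k'c s(2) xc by algebra
  also have "\<dots> \<in> K"
    using kr(1) s(1) xc by (intro K.a_closed K.I_r_closed)
  finally have "a \<in> K"
    by (rule cancel_one_minus[OF K x s(2) c(1)])
  then have "M = K"
    using a(3) Idl_of_ideal[OF K] by (simp add: insert_absorb)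
  then show "b \<in> K" using a(2) by simp
qed

section \<open>Regular sequences modulo an ideal\<close>

definition nonzerodivisor_mod :: "('a, 'b) ring_scheme \<Rightarrow> 'a set \<Rightarrow> 'a \<Rightarrow> bool"
  where "nonzerodivisor_mod A K x \<longleftrightarrow>
    x \<in> carrier A \<and> (\<forall>a\<in>carrier A. x \<otimes>\<^bsub>A\<^esub> a \<in> K \<longrightarrow> a \<in> K)"

text \<open>Regular sequences on the quotient by \<open>K\<close>. Keeping the ideal as a parameter allows
  inductions over the sequence to stay inside one ring.\<close>

primrec regular_mod :: "('a, 'b) ring_scheme \<Rightarrow> 'a set \<Rightarrow> 'a list \<Rightarrow> bool"
  where
    "regular_mod A K [] \<longleftrightarrow> K \<noteq> carrier A"
  | "regular_mod A K (x # xs) \<longleftrightarrow>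
      nonzerodivisor_mod A K x \<and> regular_mod A (genideal A (insert x K)) xs"

lemma nonzerodivisor_modD:
  assumes "nonzerodivisor_mod A K x"
  shows "x \<in> carrier A" "a \<in> carrier A \<Longrightarrow> x \<otimes>\<^bsub>A\<^esub> a \<in> K \<Longrightarrow> a \<in> K"
  using assms by (auto simp: nonzerodivisor_mod_def)

lemma (in ring) regular_mod_carrier: "regular_mod R K xs \<Longrightarrow> set xs \<subseteq> carrier R"
  by (induction xs arbitrary: K) (auto simp: nonzerodivisor_mod_def)

lemma (in ring) regular_mod_append:
  assumes "ideal K R" "regular_mod R K xs"
  shows "regular_mod R K (xs @ ys) \<longleftrightarrow> regular_mod R (Idl (K \<union> set xs)) ys"
  using assms
proof (induction xs arbitrary: K)
  case Nil
  then show ?case by (simp add: Idl_of_ideal)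
next
  case (Cons x xs)
  then have x: "x \<in> carrier R" "set xs \<subseteq> carrier R"
    using regular_mod_carrier[OF Cons.prems(2)] by auto
  show ?case
    using Cons.IH[OF Idl_insert_ideal[OF Cons.prems(1) x(1)]] Cons.prems(2)
      Idl_insert_Un[OF Cons.prems(1) x]
    by simp
qed

lemma (in ring) regular_mod_Idl_proper:
  "ideal K R \<Longrightarrow> regular_mod R K xs \<Longrightarrow> Idl (K \<union> set xs) \<noteq> carrier R"
proof (induction xs arbitrary: K)
  case Nil
  then show ?case by (simp add: Idl_of_ideal)
next
  case (Cons x xs)
  then have x: "x \<in> carrier R" "set xs \<subseteq> carrier R"
    using regular_mod_carrier[OF Cons.prems(2)] by auto
  show ?case
    using Cons.IH[OF Idl_insert_ideal[OF Cons.prems(1) x(1)]] Cons.prems(2)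
      Idl_insert_Un[OF Cons.prems(1) x]
    by simp
qed

lemma (in ring) regular_mod_proper:
  assumes "ideal K R" "regular_mod R K xs"
  shows "K \<noteq> carrier R"
proof
  assume "K = carrier R"
  moreover have sub: "K \<union> set xs \<subseteq> carrier R"
    using assms ideal_subset_carrier regular_mod_carrier by simp
  ultimately have "Idl (K \<union> set xs) = carrier R"
    using genideal_self[OF sub] ideal_subset_carrier[OF genideal_ideal[OF sub]] by blast
  then show False using regular_mod_Idl_proper[OF assms] by simp
qed

lemma (in local_ring) regular_mod_max_ideal:
  assumes "ideal K R" "regular_mod R K xs"
  shows "Idl (K \<union> set xs) \<subseteq> max_ideal R" "K \<subseteq> max_ideal R" "set xs \<subseteq> max_ideal R"
proof -
  have sub: "K \<union> set xs \<subseteq> carrier R"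
    using assms ideal_subset_carrier regular_mod_carrier by simp
  show "Idl (K \<union> set xs) \<subseteq> max_ideal R"
    using proper_ideal_subset_max_ideal[OF genideal_ideal[OF sub] regular_mod_Idl_proper[OF assms]] .
  then show "K \<subseteq> max_ideal R" "set xs \<subseteq> max_ideal R"
    using genideal_self[OF sub] by auto
qed

lemma (in local_ring) Idl_insert_proper:
  assumes "ideal K R" "K \<noteq> carrier R" "x \<in> max_ideal R"
  shows "Idl (insert x K) \<noteq> carrier R"
proof -
  have "Idl (insert x K) \<subseteq> max_ideal R"
    using proper_ideal_subset_max_ideal[OF assms(1,2)] assms(3)
    by (intro genideal_minimal max_ideal_ideal) simp
  then show ?thesis using one_notin_max_ideal by blast
qed

lemma (in cring) nonzerodivisor_mod_power:
  assumes x: "nonzerodivisor_mod R K x" and "y \<in> carrier R" "y \<otimes> x [^] (n::nat) \<in> K"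
  shows "y \<in> K"
  using assms(2,3)
proof (induction n)
  case (Suc n)
  note xc = nonzerodivisor_modD(1)[OF x]
  have "y \<otimes> x [^] Suc n = x \<otimes> (y \<otimes> x [^] n)"
    using Suc.prems(1) xc by (simp add: m_ac)
  then have "y \<otimes> x [^] n \<in> K"
    using nonzerodivisor_modD(2)[OF x, of "y \<otimes> x [^] n"] Suc.prems xc by simp
  then show ?case using Suc by blast
qed simp

text \<open>If no element of \<open>L\<close> worked, \<open>L\<close> would be covered by the finitely many associated primes of
  \<open>K\<^sub>1\<close> and \<open>K\<^sub>2\<close>, hence contained in a single colon ideal \<open>(K\<^sub>i : a)\<close>. A class that
  all of \<open>L\<close> annihilates is how depth zero presents itself when \<open>L\<close> is the maximal ideal.\<close>

lemma (in local_ring) common_nonzerodivisor: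
  assumes K: "ideal K\<^sub>1 R" "ideal K\<^sub>2 R" and L: "ideal L R"
    and colon: "\<And>K a. K \<in> {K\<^sub>1, K\<^sub>2} \<Longrightarrow> a \<in> carrier R \<Longrightarrow> L \<subseteq> ideal_colon R K {a} \<Longrightarrow> a \<in> K"
  obtains z where "z \<in> L" "nonzerodivisor_mod R K\<^sub>1 z" "nonzerodivisor_mod R K\<^sub>2 z"
proof (rule ccontr)
  assume neg: "\<not> thesis"
  have zero_divisor: "\<exists>P\<in>associated_primes R K. z \<in> P"
    if z: "ideal K R" "z \<in> L" "\<not> nonzerodivisor_mod R K z" for K z
  proof -
    have "z \<in> carrier R" using z(2) ideal.Icarr[OF L] by simp
    then obtain a where a: "a \<in> carrier R" "z \<otimes> a \<in> K" "a \<notin> K"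
      using z(3) unfolding nonzerodivisor_mod_def by blast
    then have "z \<in> ideal_colon R K {a}"
      using \<open>z \<in> carrier R\<close> by (simp add: mem_ideal_colon_singleton)
    then show ?thesis
      using colon_subset_associated_prime[OF z(1) a(1,3)] by blast
  qed
  let ?A = "associated_primes R K\<^sub>1 \<union> associated_primes R K\<^sub>2"
  have "L \<subseteq> \<Union>?A"
    using zero_divisor[OF K(1)] zero_divisor[OF K(2)] neg that by blast
  moreover have "finite ?A"
    using finite_associated_primes K by simp
  moreover have "primeideal P R" if "P \<in> ?A" for P
    using that unfolding associated_primes_def by blast
  ultimately obtain P where P: "P \<in> ?A" "L \<subseteq> P"
    using prime_avoidance[OF _ _ L] by metis
  obtain K a where "K \<in> {K\<^sub>1, K\<^sub>2}" "a \<in> carrier R" "primeideal P R" "P = ideal_colon R K {a}"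
    using P(1) unfolding associated_primes_def by blast
  moreover from this have "a \<in> K"
    using colon P(2) by blast
  moreover have "ideal K R"
    using \<open>K \<in> {K\<^sub>1, K\<^sub>2}\<close> K by blast
  ultimately show False
    using ideal_colon_eq_carrier_iff[of K a] primeideal.I_notcarr[of P R] by metis
qed

text \<open>The colon ideal \<open>(K : y)\<close> is contained in \<open>K + x (K : y)\<close>, so Nakayama's lemma makes \<open>y\<close> a nonzerodivisor
  modulo \<open>K\<close>; the other half is a direct computation.\<close>

lemma (in local_ring) nonzerodivisor_mod_swap:
  assumes K: "ideal K R" and x: "x \<in> max_ideal R" "nonzerodivisor_mod R K x"
    and y: "nonzerodivisor_mod R (Idl (insert x K)) y"
  shows "nonzerodivisor_mod R K y" "nonzerodivisor_mod R (Idl (insert y K)) x"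
proof -
  interpret K: ideal K R by (rule K)
  note xc = nonzerodivisor_modD(1)[OF x(2)] and yc = nonzerodivisor_modD(1)[OF y]
  note Kx = mem_Idl_insert_iff[OF K xc] and Ky = mem_Idl_insert_iff[OF K yc]
  interpret Kx: ideal "Idl (insert x K)" R by (rule Idl_insert_ideal[OF K xc])
  have KKx: "K \<subseteq> Idl (insert x K)" using Idl_insert_self[OF K xc] by simp
  have "ideal_colon R K {y} \<subseteq> K"
  proof (rule nakayama_single[OF K _ x(1)])
    show "ideal (ideal_colon R K {y}) R"
      using K yc by (intro ideal_colon_is_ideal) simp_all
    fix a assume "a \<in> ideal_colon R K {y}"
    then have a: "a \<in> carrier R" "a \<otimes> y \<in> K"
      by (simp_all add: mem_ideal_colon_singleton)
    then have "a \<in> Idl (insert x K)"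
      using nonzerodivisor_modD(2)[OF y a(1)] KKx yc m_comm by auto
    then obtain k r where k: "k \<in> K" and r: "r \<in> carrier R" "a = k \<oplus> r \<otimes> x"
      using Kx by blast
    have kc: "k \<in> carrier R" using k K.Icarr by simp
    have "x \<otimes> (r \<otimes> y) = (k \<oplus> r \<otimes> x) \<otimes> y \<ominus> k \<otimes> y"
      using kc r(1) xc yc by algebra
    also have "\<dots> \<in> K"
      unfolding r(2)[symmetric] a_minus_def
      by (rule K.a_closed[OF a(2) K.a_inv_closed[OF K.I_r_closed[OF k yc]]])
    finally have "r \<otimes> y \<in> K"
      using nonzerodivisor_modD(2)[OF x(2)] r(1) yc by simp
    then have "r \<in> ideal_colon R K {y}"
      using r(1) by (simp add: mem_ideal_colon_singleton)
    then show "\<exists>k\<in>K. \<exists>r\<in>ideal_colon R K {y}. a = k \<oplus> r \<otimes> x"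
      using k r(2) by blast
  qed
  then show "nonzerodivisor_mod R K y"
    using yc m_comm by (auto simp: nonzerodivisor_mod_def mem_ideal_colon_singleton)
  show "nonzerodivisor_mod R (Idl (insert y K)) x"
    unfolding nonzerodivisor_mod_def
  proof (intro conjI ballI impI xc)
    fix a assume a: "a \<in> carrier R" and "x \<otimes> a \<in> Idl (insert y K)"
    then obtain k r where k: "k \<in> K" and r: "r \<in> carrier R" "x \<otimes> a = k \<oplus> r \<otimes> y"
      using Ky by blast
    have kc: "k \<in> carrier R" using k K.Icarr by simp
    have "y \<otimes> r = a \<otimes> x \<ominus> k"
    proof -
      have "y \<otimes> r = (k \<oplus> r \<otimes> y) \<ominus> k"
        using kc r(1) yc by algebra
      also have "\<dots> = a \<otimes> x \<ominus> k"
        unfolding r(2)[symmetric] using a xc m_comm by simp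
      finally show ?thesis .
    qed
    also have "\<dots> \<in> Idl (insert x K)"
      unfolding a_minus_def using Idl_insert_self[OF K xc] a k
      by (intro Kx.a_closed Kx.a_inv_closed Kx.I_l_closed) auto
    finally have "r \<in> Idl (insert x K)"
      using nonzerodivisor_modD(2)[OF y r(1)] by simp
    then obtain k' s where k': "k' \<in> K" and s: "s \<in> carrier R" "r = k' \<oplus> s \<otimes> x"
      using Kx by blast
    have k'c: "k' \<in> carrier R" using k' K.Icarr by simp
    have "x \<otimes> (a \<ominus> s \<otimes> y) = x \<otimes> a \<ominus> s \<otimes> x \<otimes> y"
      using a s(1) xc yc by algebra
    also have "\<dots> = (k \<oplus> (k' \<oplus> s \<otimes> x) \<otimes> y) \<ominus> s \<otimes> x \<otimes> y"
      using r(2) s(2) by simp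
    also have "\<dots> = k \<oplus> k' \<otimes> y"
      using kc k'c s(1) xc yc by algebra
    also have "\<dots> \<in> K"
      using k k' yc by (intro K.a_closed K.I_r_closed)
    finally have "a \<ominus> s \<otimes> y \<in> K"
      using nonzerodivisor_modD(2)[OF x(2)] a s(1) yc by simp
    moreover have "a = (a \<ominus> s \<otimes> y) \<oplus> s \<otimes> y"
      using a s(1) yc by algebra
    ultimately show "a \<in> Idl (insert y K)"
      unfolding Ky using s(1) by blast
  qed
qed

text \<open>As \<open>x\<close> lies in the maximal ideal, \<open>x a = b z\<close> modulo \<open>K\<close> for some \<open>b\<close>. This relation is
  symmetric in the pairs \<open>(x, a)\<close> and \<open>(z, b)\<close>, and cancelling the nonzerodivisors \<open>x\<close> and \<open>z\<close> in it
  carries the two properties of \<open>a\<close> modulo \<open>K + R z\<close> over to \<open>b\<close> modulo \<open>K + R x\<close>. So depth zero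
  modulo one nonzerodivisor forces depth zero modulo every other one in the maximal ideal.\<close>

lemma (in local_ring) socle_exchange:
  assumes K: "ideal K R" and z: "nonzerodivisor_mod R K z"
    and x: "x \<in> max_ideal R" "nonzerodivisor_mod R K x"
    and a: "a \<in> carrier R" "a \<notin> Idl (insert z K)"
      "max_ideal R \<subseteq> ideal_colon R (Idl (insert z K)) {a}"
  obtains b where "b \<in> carrier R" "b \<notin> Idl (insert x K)"
    "max_ideal R \<subseteq> ideal_colon R (Idl (insert x K)) {b}"
proof -
  interpret K: ideal K R by (rule K)
  note xc = nonzerodivisor_modD(1)[OF x(2)] and zc = nonzerodivisor_modD(1)[OF z]
  note Kx = mem_Idl_insert_iff[OF K xc] and Kz = mem_Idl_insert_iff[OF K zc]
  have socle: "\<exists>k\<in>K. \<exists>c\<in>carrier R. r \<otimes> a = k \<oplus> c \<otimes> z" if "r \<in> max_ideal R" for r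
    using a(3) that Kz[of "r \<otimes> a"] by (auto simp: mem_ideal_colon_singleton)
  obtain k b where k: "k \<in> K" and b: "b \<in> carrier R" "x \<otimes> a = k \<oplus> b \<otimes> z"
    using socle[OF x(1)] by blast
  have kc: "k \<in> carrier R" using k K.Icarr by simp
  have "b \<notin> Idl (insert x K)"
  proof
    assume "b \<in> Idl (insert x K)"
    then obtain k' d where k': "k' \<in> K" and d: "d \<in> carrier R" "b = k' \<oplus> d \<otimes> x"
      using Kx by blast
    have k'c: "k' \<in> carrier R" using k' K.Icarr by simp
    have "x \<otimes> (a \<ominus> d \<otimes> z) = x \<otimes> a \<ominus> d \<otimes> x \<otimes> z"
      using a(1) d(1) xc zc by algebra
    also have "\<dots> = (k \<oplus> (k' \<oplus> d \<otimes> x) \<otimes> z) \<ominus> d \<otimes> x \<otimes> z"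
      using b(2) d(2) by simp
    also have "\<dots> = k \<oplus> k' \<otimes> z"
      using kc k'c d(1) xc zc by algebra
    also have "\<dots> \<in> K"
      using k k' zc by (intro K.a_closed K.I_r_closed)
    finally have "a \<ominus> d \<otimes> z \<in> K"
      using nonzerodivisor_modD(2)[OF x(2)] a(1) d(1) zc by simp
    moreover have "a = (a \<ominus> d \<otimes> z) \<oplus> d \<otimes> z"
      using a(1) d(1) zc by algebra
    ultimately have "a \<in> Idl (insert z K)"
      unfolding Kz using d(1) by blast
    with a(2) show False ..
  qed
  moreover have "r \<in> ideal_colon R (Idl (insert x K)) {b}" if r: "r \<in> max_ideal R" for r
  proof -
    have rc: "r \<in> carrier R" using r by (rule max_ideal_carrier)
    obtain k' c where k': "k' \<in> K" and c: "c \<in> carrier R" "r \<otimes> a = k' \<oplus> c \<otimes> z"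
      using socle[OF r] by blast
    have k'c: "k' \<in> carrier R" using k' K.Icarr by simp
    have "z \<otimes> (r \<otimes> b \<ominus> x \<otimes> c) = r \<otimes> (k \<oplus> b \<otimes> z) \<ominus> x \<otimes> (k' \<oplus> c \<otimes> z) \<oplus> x \<otimes> k' \<ominus> r \<otimes> k"
      using rc b(1) c(1) xc zc kc k'c by algebra
    also have "r \<otimes> (k \<oplus> b \<otimes> z) \<ominus> x \<otimes> (k' \<oplus> c \<otimes> z) = \<zero>"
      unfolding b(2)[symmetric] c(2)[symmetric] using rc xc a(1) by algebra
    also have "\<zero> \<oplus> x \<otimes> k' \<ominus> r \<otimes> k \<in> K"
      unfolding a_minus_def using k k' rc xc
      by (intro K.a_closed K.a_inv_closed K.I_l_closed K.zero_closed)
    finally have "r \<otimes> b \<ominus> x \<otimes> c \<in> K"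
      using nonzerodivisor_modD(2)[OF z] rc b(1) xc c(1) by simp
    moreover have "r \<otimes> b = (r \<otimes> b \<ominus> x \<otimes> c) \<oplus> c \<otimes> x"
      using rc b(1) xc c(1) by algebra
    ultimately have "r \<otimes> b \<in> Idl (insert x K)"
      unfolding Kx using c(1) by blast
    then show ?thesis
      using rc by (simp add: mem_ideal_colon_singleton)
  qed
  ultimately show ?thesis using b(1) that by blast
qed

text \<open>This makes depth independent of choices: any nonzerodivisor \<open>z\<close> of the maximal ideal may begin a
  sequence of the given length. By \<open>socle_exchange\<close>, some \<open>w\<close> is a nonzerodivisor modulo both
  \<open>K + R x\<close> and \<open>K + R z\<close>, where \<open>x\<close> is the first member of the given sequence; the induction
  hypothesis replaces the rest of that sequence by one that begins with \<open>w\<close>, swapping brings \<open>w\<close> to the front, and a second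
  application modulo \<open>K + R w\<close> exchanges \<open>x\<close> for \<open>z\<close>.\<close>

lemma (in local_ring) regular_mod_insert:
  assumes "ideal K R" "z \<in> max_ideal R" "nonzerodivisor_mod R K z"
    and "regular_mod R K xs" "length xs = Suc n"
  shows "\<exists>ys. length ys = n \<and> regular_mod R (Idl (insert z K)) ys"
  using assms
proof (induction n arbitrary: K z xs)
  case 0
  then have "regular_mod R (Idl (insert z K)) []"
    using Idl_insert_proper regular_mod_proper by simp
  then show ?case by blast
next
  case (Suc n)
  note K = \<open>ideal K R\<close> and z = \<open>z \<in> max_ideal R\<close> \<open>nonzerodivisor_mod R K z\<close>
  obtain x xs' where xs: "xs = x # xs'" "length xs' = Suc n"
    using Suc.prems(5) by (cases xs) auto
  obtain x2 xs'' where xs': "xs' = x2 # xs''"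
    using xs(2) by (cases xs') auto
  have nx: "nonzerodivisor_mod R K x" and reg': "regular_mod R (Idl (insert x K)) xs'"
    using Suc.prems(4) xs by auto
  have nx2: "nonzerodivisor_mod R (Idl (insert x K)) x2"
    using reg' xs' by simp
  have m: "x \<in> max_ideal R" "x2 \<in> max_ideal R"
    using regular_mod_max_ideal(3)[OF K Suc.prems(4)] xs xs' by auto
  note c = nonzerodivisor_modD(1)[OF nx] nonzerodivisor_modD(1)[OF z(2)]
  note Kx = Idl_insert_ideal[OF K c(1)] and Kz = Idl_insert_ideal[OF K c(2)]
  have no_socle_x: "a \<in> Idl (insert x K)"
    if "a \<in> carrier R" "max_ideal R \<subseteq> ideal_colon R (Idl (insert x K)) {a}" for a
    using that m(2) nonzerodivisor_modD[OF nx2] by (auto simp: mem_ideal_colon_singleton)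
  have no_socle_z: "a \<in> Idl (insert z K)"
    if "a \<in> carrier R" "max_ideal R \<subseteq> ideal_colon R (Idl (insert z K)) {a}" for a
    using socle_exchange[OF K z(2) m(1) nx that(1) _ that(2)] no_socle_x by blast
  obtain w where w: "w \<in> max_ideal R" "nonzerodivisor_mod R (Idl (insert x K)) w"
      "nonzerodivisor_mod R (Idl (insert z K)) w"
    using common_nonzerodivisor[OF Kx Kz max_ideal_ideal] no_socle_x no_socle_z by blast
  note wc = nonzerodivisor_modD(1)[OF w(2)]
  note Kw = Idl_insert_ideal[OF K wc]
  obtain ys where ys: "length ys = n" "regular_mod R (Idl (insert w (Idl (insert x K)))) ys"
    using Suc.IH[OF Kx w(1,2) reg' xs(2)] by blast
  have "nonzerodivisor_mod R (Idl (insert w K)) x"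
    using nonzerodivisor_mod_swap(2)[OF K m(1) nx w(2)] .
  then have "regular_mod R (Idl (insert w K)) (x # ys)"
    using ys(2) Idl_insert_commute[OF K c(1) wc] by simp
  moreover have "nonzerodivisor_mod R (Idl (insert w K)) z"
    using nonzerodivisor_mod_swap(2)[OF K z w(3)] .
  ultimately obtain us where us: "length us = n"
      "regular_mod R (Idl (insert z (Idl (insert w K)))) us"
    using Suc.IH[OF Kw z(1)] ys(1) by fastforce
  have "regular_mod R (Idl (insert z K)) (w # us)"
    using w(3) us(2) Idl_insert_commute[OF K c(2) wc] by simp
  then show ?case
    using us(1) by (intro exI[of _ "w # us"]) simp
qed

text \<open>A common nonzerodivisor can always be chosen first, since by \<open>regular_mod_insert\<close> no choice
  shortens the sequences that are still available modulo it.\<close>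

lemma (in local_ring) common_regular_sequence:
  assumes "ideal K\<^sub>1 R" "ideal K\<^sub>2 R" "regular_mod R K\<^sub>1 xs\<^sub>1" "regular_mod R K\<^sub>2 xs\<^sub>2"
    and "length xs\<^sub>1 = n" "length xs\<^sub>2 = n"
  shows "\<exists>zs. length zs = n \<and> regular_mod R K\<^sub>1 zs \<and> regular_mod R K\<^sub>2 zs"
  using assms
proof (induction n arbitrary: K\<^sub>1 K\<^sub>2 xs\<^sub>1 xs\<^sub>2)
  case 0
  then show ?case by auto
next
  case (Suc n)
  note K = \<open>ideal K\<^sub>1 R\<close> \<open>ideal K\<^sub>2 R\<close>
  have no_socle: "a \<in> K"
    if "ideal K R" "regular_mod R K xs" "length xs = Suc n" "a \<in> carrier R"
      "max_ideal R \<subseteq> ideal_colon R K {a}" for K xs a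
  proof -
    obtain x xs' where xs: "xs = x # xs'"
      using \<open>length xs = Suc n\<close> by (cases xs) auto
    have "nonzerodivisor_mod R K x" "x \<in> max_ideal R"
      using that(2) regular_mod_max_ideal(3)[OF that(1,2)] xs by auto
    then show ?thesis
      using nonzerodivisor_modD[of R K x] that(4,5) by (auto simp: mem_ideal_colon_singleton)
  qed
  obtain z where z: "z \<in> max_ideal R" "nonzerodivisor_mod R K\<^sub>1 z" "nonzerodivisor_mod R K\<^sub>2 z"
    using common_nonzerodivisor[OF K max_ideal_ideal]
      no_socle[OF K(1) Suc.prems(3,5)] no_socle[OF K(2) Suc.prems(4,6)] by blast
  note zc = nonzerodivisor_modD(1)[OF z(2)]
  obtain ys\<^sub>1 where ys1: "length ys\<^sub>1 = n" "regular_mod R (Idl (insert z K\<^sub>1)) ys\<^sub>1"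
    using regular_mod_insert[OF K(1) z(1,2) Suc.prems(3,5)] by blast
  obtain ys\<^sub>2 where ys2: "length ys\<^sub>2 = n" "regular_mod R (Idl (insert z K\<^sub>2)) ys\<^sub>2"
    using regular_mod_insert[OF K(2) z(1,3) Suc.prems(4,6)] by blast
  obtain zs where "length zs = n" "regular_mod R (Idl (insert z K\<^sub>1)) zs"
      "regular_mod R (Idl (insert z K\<^sub>2)) zs"
    using Suc.IH[OF Idl_insert_ideal[OF K(1) zc] Idl_insert_ideal[OF K(2) zc]
        ys1(2) ys2(2) ys1(1) ys2(1)] by blast
  then show ?case
    using z by (intro exI[of _ "z # zs"]) simp
qed

lemma (in local_ring) regular_mod_quotient_length:
  assumes "ideal K R" "regular_mod R K xs" "regular_mod R K ys" "length ys = length xs + n"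
  shows "\<exists>zs. length zs = n \<and> regular_mod R (Idl (K \<union> set xs)) zs"
  using assms
proof (induction xs arbitrary: K ys)
  case Nil
  then show ?case by (auto simp: Idl_of_ideal)
next
  case (Cons x xs)
  have x: "x \<in> carrier R" "set xs \<subseteq> carrier R" "x \<in> max_ideal R" "nonzerodivisor_mod R K x"
    using regular_mod_carrier[OF Cons.prems(2)] regular_mod_max_ideal(3)[OF Cons.prems(1,2)]
      Cons.prems(2) by auto
  obtain us where us: "length us = length xs + n" "regular_mod R (Idl (insert x K)) us"
    using regular_mod_insert[OF Cons.prems(1) x(3,4) Cons.prems(3), of "length xs + n"] Cons.prems(4)
    by auto
  then show ?case
    using Cons.IH[OF Idl_insert_ideal[OF Cons.prems(1) x(1)] _ us(2,1)] Cons.prems(2)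
      Idl_insert_Un[OF Cons.prems(1) x(1,2)] by simp
qed

text \<open>A regular sequence whose ideal is maximal among those generated by regular sequences has
  maximal length: a longer one would, by \<open>regular_mod_quotient_length\<close>, leave a nonzerodivisor with
  which the first could be continued.\<close>

lemma (in local_ring) regular_mod_length_bounded:
  assumes K: "ideal K R"
  obtains n where "\<And>ys. regular_mod R K ys \<Longrightarrow> length ys \<le> n"
proof (cases "\<exists>xs. regular_mod R K xs")
  case True
  have sub: "K \<union> set xs \<subseteq> carrier R" if "regular_mod R K xs" for xs
    using ideal_subset_carrier[OF K] regular_mod_carrier[OF that] by simp
  let ?F = "{Idl (K \<union> set xs) | xs. regular_mod R K xs}"
  have "?F \<noteq> {}" using True by blast
  then obtain M where M: "M \<in> ?F" and max: "\<And>L. L \<in> ?F \<Longrightarrow> M \<subseteq> L \<Longrightarrow> L = M"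
    by (rule ideal_maximal_element) (use genideal_ideal sub in auto)
  obtain xs where xs: "M = Idl (K \<union> set xs)" "regular_mod R K xs"
    using M by blast
  have Mideal: "ideal M R"
    using xs sub genideal_ideal by simp
  have "length ys \<le> length xs" if ys: "regular_mod R K ys" for ys
  proof (rule ccontr)
    assume "\<not> ?thesis"
    then obtain n where "length ys = length xs + Suc n"
      by (metis less_imp_Suc_add not_le_imp_less add_Suc_right)
    then obtain zs where zs: "length zs = Suc n" "regular_mod R M zs"
      using regular_mod_quotient_length[OF K xs(2) ys] xs(1) by blast
    then obtain z zs' where z: "zs = z # zs'" by (cases zs) auto
    have nz: "nonzerodivisor_mod R M z" and zm: "z \<in> max_ideal R"
      using zs(2) regular_mod_max_ideal(3)[OF Mideal zs(2)] z by auto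
    have "regular_mod R M [z]"
      using nz Idl_insert_proper[OF Mideal regular_mod_proper[OF Mideal zs(2)] zm] by simp
    then have reg: "regular_mod R K (xs @ [z])"
      using regular_mod_append[OF K xs(2)] xs(1) by simp
    have self: "K \<union> set (xs @ [z]) \<subseteq> Idl (K \<union> set (xs @ [z]))"
      by (rule genideal_self[OF sub[OF reg]])
    have "M \<subseteq> Idl (K \<union> set (xs @ [z]))"
      unfolding xs(1) using self by (intro genideal_minimal genideal_ideal sub[OF reg]) auto
    then have "Idl (K \<union> set (xs @ [z])) = M"
      using reg by (intro max) blast+
    then have "z \<in> M" using self by auto
    \<comment> \<open>A nonzerodivisor modulo a proper ideal is not zero modulo that ideal.\<close>
    then have "\<one> \<in> M"
      using nonzerodivisor_modD(2)[OF nz one_closed] nonzerodivisor_modD(1)[OF nz] by simp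
    then show False
      using ideal.one_imp_carrier[OF Mideal] regular_mod_proper[OF Mideal zs(2)] by simp
  qed
  then show ?thesis using that by blast
qed (use that in blast)

section \<open>Chains of prime ideals\<close>

lemma prime_chain_Cons:
  assumes "primeideal Q A" "prime_chain A n P" "Q \<subset> P 0"
  shows "prime_chain A (Suc n) (case_nat Q P)"
  using assms unfolding prime_chain_def by (auto split: nat.split)

lemma prime_chain_snoc:
  assumes "primeideal Q A" "prime_chain A n P" "P n \<subset> Q"
  shows "prime_chain A (Suc n) (P(Suc n := Q))"
  using assms unfolding prime_chain_def by (auto simp: less_Suc_eq le_Suc_eq)

lemma (in local_ring) prime_disjoint_from_multiplicative_set:
  assumes K: "ideal K R" and T: "T \<subseteq> carrier R" "\<one> \<in> T" "\<And>s t. s \<in> T \<Longrightarrow> t \<in> T \<Longrightarrow> s \<otimes> t \<in> T"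
    and "K \<inter> T = {}"
  obtains P where "primeideal P R" "K \<subseteq> P" "P \<inter> T = {}"
proof -
  let ?F = "{L. ideal L R \<and> K \<subseteq> L \<and> L \<inter> T = {}}"
  have "?F \<noteq> {}" using assms by blast
  then obtain M where M: "M \<in> ?F" and max: "\<And>L. L \<in> ?F \<Longrightarrow> M \<subseteq> L \<Longrightarrow> L = M"
    by (rule ideal_maximal_element) auto
  interpret M: ideal M R using M by blast
  have meets: "\<exists>k\<in>M. \<exists>r\<in>carrier R. k \<oplus> r \<otimes> u \<in> T" if u: "u \<in> carrier R" "u \<notin> M" for u
  proof -
    have id: "ideal (Idl (insert u M)) R" and self: "insert u M \<subseteq> Idl (insert u M)"
      using Idl_insert_ideal[OF M.is_ideal u(1)] Idl_insert_self[OF M.is_ideal u(1)] by blast+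
    have "Idl (insert u M) \<inter> T \<noteq> {}"
      using max[of "Idl (insert u M)"] id self M u(2) by blast
    then obtain t where t: "t \<in> T" "t \<in> Idl (insert u M)" by blast
    show ?thesis
      using t(1) t(2)[unfolded mem_Idl_insert_iff[OF M.is_ideal u(1)]] by blast
  qed
  have "primeideal M R"
  proof (rule primeidealI[OF M.is_ideal is_cring])
    show "carrier R \<noteq> M" using M T by blast
    fix u v assume uv: "u \<in> carrier R" "v \<in> carrier R" "u \<otimes> v \<in> M"
    show "u \<in> M \<or> v \<in> M"
    proof (rule ccontr)
      assume "\<not> (u \<in> M \<or> v \<in> M)"
      then obtain k r k' r' where kr: "k \<in> M" "r \<in> carrier R" "k \<oplus> r \<otimes> u \<in> T"
        "k' \<in> M" "r' \<in> carrier R" "k' \<oplus> r' \<otimes> v \<in> T"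
        using meets[OF uv(1)] meets[OF uv(2)] by blast
      have kc: "k \<in> carrier R" "k' \<in> carrier R" using kr M.Icarr by simp_all
      have "(k \<oplus> r \<otimes> u) \<otimes> (k' \<oplus> r' \<otimes> v)
          = k \<otimes> (k' \<oplus> r' \<otimes> v) \<oplus> (r \<otimes> u) \<otimes> k' \<oplus> (r \<otimes> r') \<otimes> (u \<otimes> v)"
        using kr(2,5) uv(1,2) kc by algebra
      also have "\<dots> \<in> M"
        using kr uv kc by (intro M.a_closed M.I_l_closed[OF uv(3)] M.I_l_closed[OF kr(4)]
            M.I_r_closed[OF kr(1)]) simp_all
      finally show False using T(3)[OF kr(3,6)] M by blast
    qed
  qed
  then show ?thesis using M that by blast
qed

text \<open>The products \<open>y x\<^sup>n\<close> with \<open>y \<notin> P\<close> form a multiplicative set, disjoint from \<open>K\<close> as \<open>x\<close> may be cancelled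
  modulo \<open>K\<close>; a prime disjoint from it is contained in \<open>P\<close> and omits \<open>x\<close>.\<close>

lemma (in local_ring) prime_below_nonzerodivisor:
  assumes K: "ideal K R" and x: "nonzerodivisor_mod R K x"
    and P: "primeideal P R" "insert x K \<subseteq> P"
  obtains Q where "primeideal Q R" "K \<subseteq> Q" "Q \<subset> P"
proof -
  interpret P: primeideal P R by (rule P(1))
  note xc = nonzerodivisor_modD(1)[OF x]
  define T where "T = {y \<otimes> x [^] n | y (n::nat). y \<in> carrier R - P}"
  have oneP: "\<one> \<notin> P" using P.one_imp_carrier P.I_notcarr by blast
  have TI: "y \<otimes> x [^] n \<in> T" if "y \<in> carrier R" "y \<notin> P" for y and n :: nat
    unfolding T_def using that by blast
  have "K \<inter> T = {}"
    using nonzerodivisor_mod_power[OF x] P(2) unfolding T_def by blast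
  moreover have "T \<subseteq> carrier R"
    unfolding T_def using xc by auto
  moreover have "\<one> \<in> T"
    using TI[OF one_closed oneP, of 0] by simp
  moreover have "s \<otimes> t \<in> T" if st: "s \<in> T" "t \<in> T" for s t
  proof -
    obtain y n y' n' where y: "s = y \<otimes> x [^] (n::nat)" "y \<in> carrier R" "y \<notin> P"
      "t = y' \<otimes> x [^] (n'::nat)" "y' \<in> carrier R" "y' \<notin> P"
      using st unfolding T_def by blast
    have "s \<otimes> t = (y \<otimes> y') \<otimes> x [^] (n + n')"
      using y xc by (simp add: nat_pow_mult[symmetric] m_ac)
    then show ?thesis
      using TI[of "y \<otimes> y'"] P.I_prime y by auto
  qed
  ultimately obtain Q where Q: "primeideal Q R" "K \<subseteq> Q" "Q \<inter> T = {}"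
    using prime_disjoint_from_multiplicative_set[OF K] by metis
  have "Q \<subseteq> P"
  proof
    fix y assume y: "y \<in> Q"
    then have "y \<in> carrier R"
      using ideal.Icarr[OF primeideal.axioms(1)[OF Q(1)]] by blast
    then show "y \<in> P"
      using TI[of y 0] y Q(3) by auto
  qed
  moreover have "x \<in> T"
    using TI[OF one_closed oneP, of 1] xc by simp
  ultimately show ?thesis
    using Q P(2) that by blast
qed

lemma (in local_ring) regular_mod_prime_chain_below:
  assumes "ideal K R" "regular_mod R K xs" "primeideal Q R" "K \<union> set xs \<subseteq> Q"
  shows "\<exists>P. prime_chain R (length xs) P \<and> K \<subseteq> P 0 \<and> P (length xs) = Q"
  using assms
proof (induction xs arbitrary: K)
  case Nil
  then show ?case
    by (intro exI[of _ "\<lambda>_. Q"]) (simp add: prime_chain_def)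
next
  case (Cons x xs)
  note K = \<open>ideal K R\<close>
  have x: "nonzerodivisor_mod R K x" using Cons.prems(2) by simp
  note xc = nonzerodivisor_modD(1)[OF x]
  interpret Q: primeideal Q R by fact
  have "Idl (insert x K) \<subseteq> Q"
    using Cons.prems(4) by (intro genideal_minimal Q.is_ideal) auto
  then obtain P where P: "prime_chain R (length xs) P" "Idl (insert x K) \<subseteq> P 0" "P (length xs) = Q"
    using Cons.IH[OF Idl_insert_ideal[OF K xc]] Cons.prems by auto
  have "primeideal (P 0) R" using P(1) unfolding prime_chain_def by blast
  moreover have "insert x K \<subseteq> P 0"
    using P(2) Idl_insert_self[OF K xc] by blast
  ultimately obtain P' where P': "primeideal P' R" "K \<subseteq> P'" "P' \<subset> P 0"
    by (rule prime_below_nonzerodivisor[OF K x])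
  show ?case
    using prime_chain_Cons[OF P'(1) P(1) P'(3)] P'(2) P(3)
    by (intro exI[of _ "case_nat P' P"]) simp
qed

text \<open>For \<open>P = (K : a)\<close> the elements annihilated by \<open>P\<close> modulo \<open>K\<close> are not all divisible by \<open>x\<close>,
  since \<open>x\<close> could then be divided out for ever, against Nakayama's lemma. One that is not gives
  an associated prime of \<open>K + R x\<close> above \<open>P\<close>; it contains \<open>x\<close>, which \<open>P\<close> does not.\<close>

lemma (in local_ring) regular_mod_prime_chain_above:
  assumes "ideal K R" "regular_mod R K xs" "P \<in> associated_primes R K"
  shows "\<exists>C. prime_chain R (length xs) C \<and> C 0 = P"
  using assms
proof (induction xs arbitrary: K P)
  case Nil
  then show ?case
    by (intro exI[of _ "\<lambda>_. P"]) (simp add: prime_chain_def associated_primes_def)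
next
  case (Cons x xs)
  note K = \<open>ideal K R\<close>
  interpret K: ideal K R by (rule K)
  have x: "nonzerodivisor_mod R K x" and xm: "x \<in> max_ideal R"
    using Cons.prems(2) regular_mod_max_ideal(3)[OF K Cons.prems(2)] by auto
  note xc = nonzerodivisor_modD(1)[OF x]
  note Kx = Idl_insert_ideal[OF K xc]
  obtain a where P: "primeideal P R" and a: "a \<in> carrier R" "P = ideal_colon R K {a}"
    using Cons.prems(3) unfolding associated_primes_def by blast
  interpret P: primeideal P R by (rule P)
  define N where "N = ideal_colon R K P"
  have N: "ideal N R"
    unfolding N_def using K P.a_subset by (rule ideal_colon_is_ideal)
  have aK: "a \<notin> K"
    using ideal_colon_eq_carrier_iff[OF K a(1)] a(2) P.I_notcarr by metis
  have "a \<otimes> p \<in> K" if "p \<in> P" for p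
    using that a m_comm[OF a(1), of p] by (simp add: mem_ideal_colon_singleton)
  then have "a \<in> N"
    unfolding N_def ideal_colon_def using a(1) by blast
  have "\<not> N \<subseteq> Idl (insert x K)"
  proof
    assume sub: "N \<subseteq> Idl (insert x K)"
    have "N \<subseteq> K"
    proof (rule nakayama_single[OF K N xm])
      fix b assume b: "b \<in> N"
      then obtain k r where k: "k \<in> K" and r: "r \<in> carrier R" "b = k \<oplus> r \<otimes> x"
        using sub mem_Idl_insert_iff[OF K xc] by blast
      have kc: "k \<in> carrier R" using k K.Icarr by simp
      have "r \<otimes> p \<in> K" if p: "p \<in> P" for p
      proof -
        have pc: "p \<in> carrier R" using p P.Icarr by simp
        have bp: "b \<otimes> p \<in> K" using b p unfolding N_def ideal_colon_def by blast
        have "x \<otimes> (r \<otimes> p) = (k \<oplus> r \<otimes> x) \<otimes> p \<ominus> k \<otimes> p"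
          using kc r(1) xc pc by algebra
        also have "\<dots> \<in> K"
          unfolding r(2)[symmetric] a_minus_def
          by (rule K.a_closed[OF bp K.a_inv_closed[OF K.I_r_closed[OF k pc]]])
        finally show ?thesis
          using nonzerodivisor_modD(2)[OF x] r(1) pc by simp
      qed
      then have "r \<in> N" unfolding N_def ideal_colon_def using r(1) by blast
      then show "\<exists>k\<in>K. \<exists>r\<in>N. b = k \<oplus> r \<otimes> x" using k r(2) by blast
    qed
    then show False using \<open>a \<in> N\<close> aK by blast
  qed
  then obtain b where b: "b \<in> N" "b \<notin> Idl (insert x K)" by blast
  have bc: "b \<in> carrier R" using b(1) ideal.Icarr[OF N] by simp
  obtain Q where Q: "Q \<in> associated_primes R (Idl (insert x K))"
      "ideal_colon R (Idl (insert x K)) {b} \<subseteq> Q"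
    by (rule colon_subset_associated_prime[OF Kx bc b(2)])
  have "P \<subseteq> ideal_colon R (Idl (insert x K)) {b}"
  proof
    fix p assume p: "p \<in> P"
    then have "b \<otimes> p \<in> K" "p \<in> carrier R"
      using b(1) P.Icarr unfolding N_def ideal_colon_def by blast+
    then show "p \<in> ideal_colon R (Idl (insert x K)) {b}"
      using Idl_insert_self[OF K xc] m_comm[OF bc, of p] by (simp add: mem_ideal_colon_singleton subset_iff)
  qed
  moreover have "x \<in> ideal_colon R (Idl (insert x K)) {b}"
    using Idl_insert_self[OF K xc] ideal.I_r_closed[OF Kx _ bc, of x] xc
    by (simp add: mem_ideal_colon_singleton)
  moreover have "x \<notin> P"
    unfolding a(2) mem_ideal_colon_singleton using nonzerodivisor_modD(2)[OF x a(1)] aK by blast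
  ultimately have "P \<subset> Q" using Q(2) by blast
  obtain C where "prime_chain R (length xs) C" "C 0 = Q"
    using Cons.IH[OF Kx _ Q(1)] Cons.prems(2) by auto
  then show ?case
    using prime_chain_Cons[OF P] \<open>P \<subset> Q\<close> by (intro exI[of _ "case_nat P C"]) simp
qed

section \<open>Powers of the maximal ideal\<close>

lemma (in cring) ideal_power:
  assumes "ideal L R"
  shows "ideal (L [^]\<^bsub>ideals_set R\<^esub> (n::nat)) R"
    and "L [^]\<^bsub>ideals_set R\<^esub> (1::nat) = L"
    and "L [^]\<^bsub>ideals_set R\<^esub> (m + n) =
      (L [^]\<^bsub>ideals_set R\<^esub> m) \<cdot> (L [^]\<^bsub>ideals_set R\<^esub> (n::nat))"
proof -
  interpret ideals: comm_monoid "ideals_set R"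
    by (rule ideals_set_is_comm_monoid)
  have c: "carrier (ideals_set R) = {L. ideal L R}" and m: "\<And>A B. A \<otimes>\<^bsub>ideals_set R\<^esub> B = A \<cdot> B"
    by (simp_all add: ideals_set_def)
  have L: "L \<in> carrier (ideals_set R)" using assms c by simp
  show "ideal (L [^]\<^bsub>ideals_set R\<^esub> n) R"
    using ideals.nat_pow_closed[OF L, of n] c by blast
  show "L [^]\<^bsub>ideals_set R\<^esub> (1::nat) = L"
    using ideals.nat_pow_eone[OF L] by simp
  show "L [^]\<^bsub>ideals_set R\<^esub> (m + n) =
      (L [^]\<^bsub>ideals_set R\<^esub> m) \<cdot> (L [^]\<^bsub>ideals_set R\<^esub> n)"
    using ideals.nat_pow_mult[OF L, of m n] m by simp
qed

lemma (in cring) ideal_power_mem: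
  assumes "ideal L R" "y \<in> L"
  shows "y [^] (n::nat) \<in> L [^]\<^bsub>ideals_set R\<^esub> n"
proof (induction n)
  case 0
  then show ?case by (simp add: ideals_set_def)
next
  case (Suc n)
  then show ?case
    using ideal_prod.prod[OF Suc.IH, of y L] assms(2) ideal_power(2,3)[OF assms(1)] ideal.Icarr[OF assms]
    by (metis Suc_eq_plus1 nat_pow_Suc)
qed

text \<open>An ideal \<open>L\<close> that is maximal among the counterexamples is neither prime nor the whole ring, so it
  contains a product \<open>u v\<close> of two elements outside it; the larger ideals \<open>L + R u\<close> and
  \<open>L + R v\<close> contain powers of the maximal ideal, and their product lies in \<open>L\<close>.\<close>

lemma (in local_ring) max_ideal_power_subset:
  assumes "ideal L R" and "\<And>P. primeideal P R \<Longrightarrow> L \<subseteq> P \<Longrightarrow> P = max_ideal R"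
  shows "\<exists>n\<ge>1. max_ideal R [^]\<^bsub>ideals_set R\<^esub> (n::nat) \<subseteq> L"
  using assms
proof (induction rule: ideal_induct)
  case (larger L)
  note L = \<open>ideal L R\<close>
  interpret L: ideal L R by (rule L)
  let ?m = "\<lambda>n::nat. max_ideal R [^]\<^bsub>ideals_set R\<^esub> n"
  have one: "?m 1 = max_ideal R" by (rule ideal_power(2)[OF max_ideal_ideal])
  consider "carrier R = L" | "primeideal L R"
    | u v where "u \<in> carrier R" "v \<in> carrier R" "u \<otimes> v \<in> L" "u \<notin> L" "v \<notin> L"
    using L.primeidealCD[OF is_cring] by blast
  then show ?case
  proof cases
    case 1
    then show ?thesis using one max_ideal_carrier by (intro exI[of _ 1]) auto
  next
    case 2
    then have "L = max_ideal R" using larger.prems by blast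
    then show ?thesis using one by (intro exI[of _ 1]) auto
  next
    case (3 u v)
    have power: "\<exists>n\<ge>1. ?m n \<subseteq> Idl (insert w L)" if w: "w \<in> carrier R" "w \<notin> L" for w
      using larger.IH[OF Idl_insert_ideal[OF L w(1)]] larger.prems Idl_insert_self[OF L w(1)] w(2)
      by blast
    obtain i where i: "i \<ge> 1" "?m i \<subseteq> Idl (insert u L)"
      using power[OF 3(1,4)] by blast
    obtain j where j: "?m j \<subseteq> Idl (insert v L)"
      using power[OF 3(2,5)] by blast
    have "?m i \<cdot> ?m j \<subseteq> L"
    proof
      fix s assume "s \<in> ?m i \<cdot> ?m j"
      then show "s \<in> L"
      proof (induction rule: ideal_prod.induct)
        case (prod a b)
        then have "a \<in> Idl (insert u L)" "b \<in> Idl (insert v L)"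
          using i(2) j by blast+
        then obtain k r k' r' where kr: "k \<in> L" "r \<in> carrier R" "a = k \<oplus> r \<otimes> u"
          "k' \<in> L" "r' \<in> carrier R" "b = k' \<oplus> r' \<otimes> v"
          unfolding mem_Idl_insert_iff[OF L 3(1)] mem_Idl_insert_iff[OF L 3(2)] by blast
        have kc: "k \<in> carrier R" "k' \<in> carrier R" using kr L.Icarr by simp_all
        have "a \<otimes> b = k \<otimes> (k' \<oplus> r' \<otimes> v) \<oplus> (r \<otimes> u) \<otimes> k' \<oplus> (r \<otimes> r') \<otimes> (u \<otimes> v)"
          unfolding kr(3,6) using kr(2,5) 3(1,2) kc by algebra
        also have "\<dots> \<in> L"
          using kr(2,5) 3 kc by (intro L.a_closed L.I_l_closed[OF 3(3)] L.I_l_closed[OF kr(4)]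
              L.I_r_closed[OF kr(1)]) simp_all
        finally show ?case .
      qed simp
    qed
    then show ?thesis
      using i(1) ideal_power(3)[OF max_ideal_ideal, of i j] by (intro exI[of _ "i + j"]) simp
  qed
qed

section \<open>Transfer along a surjective ring homomorphism\<close>

text \<open>All invariants of the target are expressed through the kernel \<open>K\<close> in the source. The
  canonical map onto a quotient and the identity map, with \<open>K = {0}\<close>, are both instances.\<close>

locale ring_surjection = ring_hom_cring R S h for R (structure) and S (structure) and h +
  fixes K
  assumes surj: "h ` carrier R = carrier S"
    and kernel: "a_kernel R S h = K"

lemma (in cring) ring_surjection_id: "ring_surjection R R id {\<zero>}"
proof -
  interpret id: ring_hom_cring R R id
    by (rule ring_hom_cringI) (auto intro!: ring_hom_ringI ring_axioms is_cring)
  show ?thesis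
    by standard (auto simp: a_kernel_def')
qed

lemma (in cring) ring_surjection_quotient:
  assumes "ideal J R"
  shows "ring_surjection R (R Quot J) ((+>) J) J"
proof -
  interpret J: ideal J R by fact
  interpret hom: ring_hom_cring R "R Quot J" "(+>) J"
    by (rule J.rcos_ring_hom_cring[OF is_cring])
  have surj: "(+>) J ` carrier R = carrier (R Quot J)"
    unfolding FactRing_def A_RCOSETS_def' by (simp add: UNION_singleton_eq_range)
  have "a \<in> J \<longleftrightarrow> a \<in> carrier R \<and> J +> a = J" for a
    using J.Icarr[of a] J.rcos_const_imp_mem[of a] a_rcos_zero[OF assms, of a] by argo
  then have J_eq: "{a \<in> carrier R. J +> a = J} = J" by blast
  have zero: "\<zero>\<^bsub>R Quot J\<^esub> = J"
    by (simp only: FactRing_def ring.simps)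
  have "a_kernel R (R Quot J) ((+>) J) = J"
    unfolding a_kernel_def' zero by (rule J_eq)
  then show ?thesis
    by (intro ring_surjection.intro ring_surjection_axioms.intro hom.ring_hom_cring_axioms surj)
qed

context ring_surjection
begin

lemma kernel_mem_iff: "a \<in> K \<longleftrightarrow> a \<in> carrier R \<and> h a = \<zero>\<^bsub>S\<^esub>"
  using kernel unfolding a_kernel_def' by blast

lemma kernel_ideal: "ideal K R"
  using ring.kernel_is_ideal unfolding kernel .

lemma kernel_subset: "K \<subseteq> carrier R"
  using kernel_mem_iff by blast

lemma surjE:
  assumes "b \<in> carrier S"
  obtains a where "a \<in> carrier R" "b = h a"
  using assms surj by blast

lemma image_mem_iff:
  assumes L: "ideal L R" "K \<subseteq> L" and a: "a \<in> carrier R"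
  shows "h a \<in> h ` L \<longleftrightarrow> a \<in> L"
proof
  interpret L: ideal L R by fact
  assume "h a \<in> h ` L"
  then obtain b where b: "b \<in> L" "h a = h b" by blast
  have bc: "b \<in> carrier R" using b L.Icarr by simp
  have "h (a \<ominus> b) = \<zero>\<^bsub>S\<^esub>"
    using a bc b(2) by (simp add: R.minus_eq S.r_neg)
  then have "a \<ominus> b \<in> L"
    using kernel_mem_iff L(2) a bc by auto
  then have "(a \<ominus> b) \<oplus> b \<in> L"
    using b(1) by simp
  moreover have "(a \<ominus> b) \<oplus> b = a"
    using a bc by algebra
  ultimately show "a \<in> L" by simp
qed simp

lemma image_ideal:
  assumes "ideal L R"
  shows "ideal (h ` L) S"
proof -
  interpret L: ideal L R by fact
  show ?thesis
  proof (rule idealI[OF S.ring_axioms])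
    show "subgroup (h ` L) (add_monoid S)"
      by (rule ring.img_is_add_subgroup[OF L.a_subgroup])
    fix a x assume "a \<in> h ` L" "x \<in> carrier S"
    then obtain b y where b: "b \<in> L" "a = h b" and y: "y \<in> carrier R" "x = h y"
      using surj by blast
    have "h (y \<otimes> b) \<in> h ` L" "h (b \<otimes> y) \<in> h ` L"
      using b y L.I_l_closed L.I_r_closed by blast+
    then show "x \<otimes>\<^bsub>S\<^esub> a \<in> h ` L" "a \<otimes>\<^bsub>S\<^esub> x \<in> h ` L"
      using b y L.Icarr by simp_all
  qed
qed

definition preimage :: "'c set \<Rightarrow> 'a set"
  where "preimage L = {r \<in> carrier R. h r \<in> L}"

lemma preimage_ideal:
  assumes "ideal L S"
  shows "ideal (preimage L) R" "K \<subseteq> preimage L"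
proof -
  show "ideal (preimage L) R"
    unfolding preimage_def by (rule ring.ideal_vimage[OF assms])
  show "K \<subseteq> preimage L"
    unfolding preimage_def
    using kernel_mem_iff additive_subgroup.zero_closed[OF ideal.axioms(1)[OF assms]] by auto
qed

lemma image_preimage:
  assumes "ideal L S"
  shows "h ` preimage L = L"
proof
  show "L \<subseteq> h ` preimage L"
  proof
    fix b assume b: "b \<in> L"
    then obtain a where "a \<in> carrier R" "b = h a"
      using surjE[OF ideal.Icarr[OF assms b]] by metis
    then show "b \<in> h ` preimage L" using b by (simp add: preimage_def)
  qed
qed (auto simp: preimage_def)

lemma genideal_image:
  assumes "A \<subseteq> carrier R"
  shows "genideal S (h ` A) = h ` (Idl (K \<union> A))"
proof
  have KA: "K \<union> A \<subseteq> carrier R" using assms kernel_subset by simp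
  have hA: "h ` A \<subseteq> carrier S" using assms by auto
  show "genideal S (h ` A) \<subseteq> h ` (Idl (K \<union> A))"
    using R.genideal_self[OF KA] by (intro S.genideal_minimal image_ideal R.genideal_ideal KA) blast
  note id = S.genideal_ideal[OF hA]
  have "A \<subseteq> preimage (genideal S (h ` A))"
    using assms S.genideal_self[OF hA] unfolding preimage_def by blast
  then have "Idl (K \<union> A) \<subseteq> preimage (genideal S (h ` A))"
    using preimage_ideal[OF id] by (intro R.genideal_minimal) auto
  then show "h ` (Idl (K \<union> A)) \<subseteq> genideal S (h ` A)"
    using image_preimage[OF id] by blast
qed

lemma image_eq_carrier_iff:
  assumes L: "ideal L R" "K \<subseteq> L"
  shows "h ` L = carrier S \<longleftrightarrow> L = carrier R"
proof
  assume eq: "h ` L = carrier S"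
  then have "h \<one> \<in> h ` L" by simp
  then have "\<one> \<in> L" using image_mem_iff[OF L] by blast
  then show "L = carrier R" using ideal.one_imp_carrier[OF L(1)] by blast
qed (use surj in blast)

lemma preimage_prime:
  assumes "primeideal P S"
  shows "primeideal (preimage P) R"
proof -
  interpret P: primeideal P S by fact
  show ?thesis
  proof (rule primeidealI[OF preimage_ideal(1)[OF P.is_ideal] R.is_cring])
    show "carrier R \<noteq> preimage P"
      using image_preimage[OF P.is_ideal] P.I_notcarr surj by metis
    fix a b assume "a \<in> carrier R" "b \<in> carrier R" "a \<otimes> b \<in> preimage P"
    then show "a \<in> preimage P \<or> b \<in> preimage P"
      using P.I_prime[of "h a" "h b"] unfolding preimage_def by simp
  qed
qed

lemma image_prime:
  assumes "primeideal Q R" "K \<subseteq> Q"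
  shows "primeideal (h ` Q) S"
proof -
  interpret Q: primeideal Q R by fact
  show ?thesis
  proof (rule primeidealI[OF image_ideal[OF Q.is_ideal] S.is_cring])
    show "carrier S \<noteq> h ` Q"
      using image_eq_carrier_iff[OF Q.is_ideal assms(2)] Q.I_notcarr by metis
    fix a b assume "a \<in> carrier S" "b \<in> carrier S" and ab: "a \<otimes>\<^bsub>S\<^esub> b \<in> h ` Q"
    then obtain x y where xy: "x \<in> carrier R" "a = h x" "y \<in> carrier R" "b = h y"
      by (metis surjE)
    then have "h (x \<otimes> y) \<in> h ` Q" using ab by simp
    then have "x \<otimes> y \<in> Q" using image_mem_iff[OF Q.is_ideal assms(2), of "x \<otimes> y"] xy(1,3) by blast
    then show "a \<in> h ` Q \<or> b \<in> h ` Q" using Q.I_prime xy by blast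
  qed
qed

lemma prime_chain_image_iff:
  "(\<exists>P. prime_chain S n P) \<longleftrightarrow> (\<exists>P. prime_chain R n P \<and> K \<subseteq> P 0)"
proof
  assume "\<exists>P. prime_chain S n P"
  then obtain P where P: "\<And>i. i \<le> n \<Longrightarrow> primeideal (P i) S" "\<And>i. i < n \<Longrightarrow> P i \<subset> P (Suc i)"
    unfolding prime_chain_def by blast
  have id: "ideal (P i) S" if "i \<le> n" for i
    using P(1)[OF that] primeideal.axioms(1) by blast
  have "preimage (P i) \<subset> preimage (P (Suc i))" if "i < n" for i
  proof -
    have "h ` preimage (P i) = P i" "h ` preimage (P (Suc i)) = P (Suc i)"
      using that by (simp_all add: image_preimage id)
    then have "preimage (P i) \<noteq> preimage (P (Suc i))"
      using P(2)[OF that] by (metis psubset_eq)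
    then show ?thesis using P(2)[OF that] unfolding preimage_def by blast
  qed
  then have "prime_chain R n (\<lambda>i. preimage (P i))"
    unfolding prime_chain_def using P(1) preimage_prime by blast
  then show "\<exists>P. prime_chain R n P \<and> K \<subseteq> P 0"
    using preimage_ideal(2)[OF id, of 0] by blast
next
  assume "\<exists>P. prime_chain R n P \<and> K \<subseteq> P 0"
  then obtain P where P: "\<And>i. i \<le> n \<Longrightarrow> primeideal (P i) R" "\<And>i. i < n \<Longrightarrow> P i \<subset> P (Suc i)"
    and K0: "K \<subseteq> P 0"
    unfolding prime_chain_def by blast
  have id: "ideal (P i) R" if "i \<le> n" for i
    using P(1)[OF that] primeideal.axioms(1) by blast
  have KP: "K \<subseteq> P i" if "i \<le> n" for i
    using that
  proof (induction i)
    case (Suc i)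
    then show ?case using P(2)[of i] by auto
  qed (rule K0)
  have "h ` P i \<subset> h ` P (Suc i)" if i: "i < n" for i
  proof -
    obtain a where a: "a \<in> P (Suc i)" "a \<notin> P i" using P(2)[OF i] by blast
    then have "h a \<notin> h ` P i"
      using image_mem_iff[OF id[of i] KP[of i], of a] ideal.Icarr[OF id[of "Suc i"], of a] i by simp
    then show ?thesis using a(1) P(2)[OF i] by blast
  qed
  then have "prime_chain S n (\<lambda>i. h ` P i)"
    unfolding prime_chain_def using image_prime[OF P(1) KP] by simp
  then show "\<exists>P. prime_chain S n P" by blast
qed

lemma krull_dim_image: "krull_dim S = Sup {enat n | n. \<exists>P. prime_chain R n P \<and> K \<subseteq> P 0}"
  unfolding krull_dim_def prime_chain_image_iff ..

lemma noetherian_image: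
  assumes "noetherian_ring R"
  shows "noetherian_ring S"
proof (rule S.noetherian_ringI)
  fix L assume L: "ideal L S"
  note pre = preimage_ideal[OF L]
  obtain A where A: "A \<subseteq> carrier R" "finite A" "preimage L = Idl A"
    using noetherian_ring.finetely_gen[OF assms pre(1)] by blast
  have KA: "K \<union> A \<subseteq> carrier R" using A(1) kernel_subset by simp
  have "Idl (K \<union> A) = preimage L"
  proof
    show "Idl (K \<union> A) \<subseteq> preimage L"
      using R.genideal_self[OF A(1)] A(3) pre by (intro R.genideal_minimal) auto
    show "preimage L \<subseteq> Idl (K \<union> A)"
      unfolding A(3) by (rule R.subset_Idl_subset[OF KA]) simp
  qed
  then have "genideal S (h ` A) = L"
    using genideal_image[OF A(1)] image_preimage[OF L] by simp
  then show "\<exists>A\<subseteq>carrier S. finite A \<and> L = genideal S A"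
    using A(1,2) by (intro exI[of _ "h ` A"]) auto
qed

lemma local_image:
  assumes "local_ring R" "K \<noteq> carrier R"
  shows "local_ring S" "max_ideal S = h ` max_ideal R"
proof -
  interpret lR: local_ring R by fact
  interpret nS: noetherian_ring S
    by (rule noetherian_image) (rule lR.noetherian_ring_axioms)
  let ?m = "max_ideal R"
  have Km: "K \<subseteq> ?m"
    by (rule lR.proper_ideal_subset_max_ideal[OF kernel_ideal assms(2)])
  have hm: "ideal (h ` ?m) S" "h ` ?m \<noteq> carrier S"
    using image_ideal[OF lR.max_ideal_ideal] image_eq_carrier_iff[OF lR.max_ideal_ideal Km]
      lR.one_notin_max_ideal by auto
  have eq: "M = h ` ?m" if M: "maximalideal M S" for M
  proof -
    interpret M: maximalideal M S by (rule M)
    have "preimage M \<noteq> carrier R"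
      using image_preimage[OF M.is_ideal] M.I_notcarr surj by metis
    then have "preimage M \<subseteq> ?m"
      using lR.proper_ideal_subset_max_ideal preimage_ideal(1)[OF M.is_ideal] by blast
    then have "M \<subseteq> h ` ?m"
      using image_preimage[OF M.is_ideal] by blast
    then show ?thesis
      using M.I_maximal[OF hm(1)] hm(2) S.ideal_subset_carrier[OF hm(1)] by blast
  qed
  obtain M where M: "maximalideal M S"
    by (rule nS.proper_ideal_subset_maximalideal[OF hm])
  have uniq: "\<exists>!M. maximalideal M S"
    using M eq by metis
  show local: "local_ring S"
    by (intro local_ring.intro local_ring_axioms.intro nS.noetherian_ring_axioms S.is_cring uniq)
  show "max_ideal S = h ` ?m"
    by (rule eq) (rule local_ring.max_ideal_is_maximal[OF local])
qed

end

lemma (in ring) regular_mod_iff_nth: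
  assumes "ideal L R" "set xs \<subseteq> carrier R"
  shows "regular_mod R L xs \<longleftrightarrow>
    (\<forall>i<length xs. \<forall>a\<in>carrier R. xs ! i \<otimes> a \<in> Idl (L \<union> set (take i xs)) \<longrightarrow>
       a \<in> Idl (L \<union> set (take i xs))) \<and> Idl (L \<union> set xs) \<noteq> carrier R"
  using assms
proof (induction xs arbitrary: L)
  case Nil
  then show ?case by (simp add: Idl_of_ideal)
next
  case (Cons x xs)
  then have x: "x \<in> carrier R" "set xs \<subseteq> carrier R" by auto
  have eq: "Idl (Idl (insert x L) \<union> set (take i xs)) = Idl (L \<union> insert x (set (take i xs)))" for i
    using x set_take_subset[of i xs] by (intro Idl_insert_Un Cons.prems(1)) auto
  show ?case
    using Cons.IH[OF Idl_insert_ideal[OF Cons.prems(1) x(1)] x(2)] x(1) Cons.prems(1)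
      Idl_insert_Un[OF Cons.prems(1) x] eq
    by (simp add: All_less_Suc2 nonzerodivisor_mod_def Idl_of_ideal)
qed

context ring_surjection
begin

lemma regular_sequence_image_iff:
  assumes xs: "set xs \<subseteq> carrier R"
  shows "regular_sequence S (map h xs) \<longleftrightarrow> regular_mod R K xs"
proof -
  let ?L = "\<lambda>i. Idl (K \<union> set (take i xs))"
  have sub: "K \<union> set (take i xs) \<subseteq> carrier R" for i
    using xs kernel_subset set_take_subset[of i xs] by blast
  have L: "ideal (?L i) R" "K \<subseteq> ?L i" for i
    using R.genideal_ideal[OF sub] R.genideal_self[OF sub] by auto
  have gen: "genideal S (set (take i (map h xs))) = h ` ?L i" for i
    using genideal_image[of "set (take i xs)"] sub[of i] by (simp add: take_map)
  have gen_all: "genideal S (set (map h xs)) = h ` (Idl (K \<union> set xs))"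
    using gen[of "length xs"] by simp
  have proper: "genideal S (set (map h xs)) = carrier S \<longleftrightarrow> Idl (K \<union> set xs) = carrier R"
    unfolding gen_all using image_eq_carrier_iff[OF L[of "length xs"]] by simp
  have step: "(\<forall>a\<in>carrier S. map h xs ! i \<otimes>\<^bsub>S\<^esub> a \<in> h ` ?L i \<longrightarrow> a \<in> h ` ?L i) \<longleftrightarrow>
      (\<forall>a\<in>carrier R. xs ! i \<otimes> a \<in> ?L i \<longrightarrow> a \<in> ?L i)" if i: "i < length xs" for i
  proof -
    have x: "xs ! i \<in> carrier R" using xs i nth_mem by blast
    have "h (xs ! i) \<otimes>\<^bsub>S\<^esub> h a \<in> h ` ?L i \<longleftrightarrow> xs ! i \<otimes> a \<in> ?L i" if "a \<in> carrier R" for a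
      using image_mem_iff[OF L[of i], of "xs ! i \<otimes> a"] x that by simp
    moreover have "h a \<in> h ` ?L i \<longleftrightarrow> a \<in> ?L i" if "a \<in> carrier R" for a
      using image_mem_iff[OF L[of i] that] .
    ultimately show ?thesis
      unfolding surj[symmetric] ball_simps using i by simp
  qed
  have "set (map h xs) \<subseteq> carrier S" using xs by auto
  then show ?thesis
    unfolding regular_sequence_def R.regular_mod_iff_nth[OF kernel_ideal xs] gen
    using step proper by auto
qed

lemma depth_image:
  assumes "local_ring R" "K \<noteq> carrier R"
  shows "depth S = Sup {enat (length xs) | xs. regular_mod R K xs}"
proof -
  interpret lR: local_ring R by fact
  have "(\<exists>ys. n = length ys \<and> set ys \<subseteq> max_ideal S \<and> regular_sequence S ys) \<longleftrightarrow>
      (\<exists>xs. n = length xs \<and> regular_mod R K xs)" for n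
  proof
    assume "\<exists>ys. n = length ys \<and> set ys \<subseteq> max_ideal S \<and> regular_sequence S ys"
    then obtain ys where ys: "n = length ys" "regular_sequence S ys" by blast
    then have "ys \<in> lists (h ` carrier R)"
      unfolding surj regular_sequence_def by auto
    then obtain xs where xs: "set xs \<subseteq> carrier R" "ys = map h xs"
      unfolding lists_image by auto
    then show "\<exists>xs. n = length xs \<and> regular_mod R K xs"
      using regular_sequence_image_iff ys by auto
  next
    assume "\<exists>xs. n = length xs \<and> regular_mod R K xs"
    then obtain xs where xs: "n = length xs" "regular_mod R K xs" by blast
    have "set (map h xs) \<subseteq> max_ideal S"
      using lR.regular_mod_max_ideal(3)[OF kernel_ideal xs(2)] local_image(2)[OF assms] by auto
    moreover have "regular_sequence S (map h xs)"
      using regular_sequence_image_iff[OF R.regular_mod_carrier[OF xs(2)]] xs(2) by simp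
    ultimately show "\<exists>ys. n = length ys \<and> set ys \<subseteq> max_ideal S \<and> regular_sequence S ys"
      using xs(1) by (intro exI[of _ "map h xs"]) simp
  qed
  then have "{enat (length ys) | ys. set ys \<subseteq> max_ideal S \<and> regular_sequence S ys} =
      {enat (length xs) | xs. regular_mod R K xs}"
    by blast
  then show ?thesis unfolding depth_def by simp
qed

lemma depth_image_attained:
  assumes "local_ring R" "K \<noteq> carrier R"
  obtains xs where "regular_mod R K xs" "depth S = enat (length xs)"
    "\<And>ys. regular_mod R K ys \<Longrightarrow> length ys \<le> length xs"
proof -
  interpret lR: local_ring R by fact
  let ?D = "{enat (length xs) | xs. regular_mod R K xs}"
  obtain n where n: "\<And>ys. regular_mod R K ys \<Longrightarrow> length ys \<le> n"
    using lR.regular_mod_length_bounded[OF kernel_ideal] by blast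
  have "finite ?D"
    by (rule finite_enat_bounded[of _ n]) (use n in auto)
  moreover have "regular_mod R K []" using assms(2) by simp
  then have "?D \<noteq> {}" by blast
  ultimately have "Sup ?D \<in> ?D"
    unfolding Sup_enat_def using Max_in by auto
  then obtain xs where xs: "regular_mod R K xs" "depth S = enat (length xs)"
    using depth_image[OF assms] by auto
  moreover have "length ys \<le> length xs" if "regular_mod R K ys" for ys
  proof -
    have "enat (length ys) \<le> Sup ?D"
      using that by (intro Sup_upper) blast
    then show ?thesis using xs(2) depth_image[OF assms] by simp
  qed
  ultimately show ?thesis using that by blast
qed

end

section \<open>Saturation, depth and height\<close>

lemma (in local_ring) saturation_eq_carrier:
  assumes "ideal L R" and "\<And>P. primeideal P R \<Longrightarrow> L \<subseteq> P \<Longrightarrow> P = max_ideal R"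
  shows "saturation R L = carrier R"
proof
  show "saturation R L \<subseteq> carrier R"
    unfolding saturation_def ideal_colon_def by blast
  obtain n where n: "n \<ge> 1" "max_ideal R [^]\<^bsub>ideals_set R\<^esub> (n::nat) \<subseteq> L"
    using max_ideal_power_subset[OF assms] by blast
  have "carrier R \<subseteq> ideal_colon R L (max_ideal R [^]\<^bsub>ideals_set R\<^esub> n)"
    using n(2) ideal.I_l_closed[OF assms(1)] unfolding ideal_colon_def by blast
  then show "carrier R \<subseteq> saturation R L"
    using n(1) unfolding saturation_def by blast
qed

lemma (in local_ring) saturation_subset_if_nonzerodivisor:
  assumes z: "z \<in> max_ideal R" "nonzerodivisor_mod R L z"
  shows "saturation R L \<subseteq> L"
proof
  fix a assume "a \<in> saturation R L"
  then obtain i :: nat where "a \<in> carrier R"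
      "\<forall>b \<in> max_ideal R [^]\<^bsub>ideals_set R\<^esub> i. a \<otimes> b \<in> L"
    unfolding saturation_def ideal_colon_def by blast
  then show "a \<in> L"
    using nonzerodivisor_mod_power[OF z(2), of a i] ideal_power_mem[OF max_ideal_ideal z(1), of i]
    by blast
qed

lemma (in local_ring) socle_subset_saturation: "ideal_colon R L (max_ideal R) \<subseteq> saturation R L"
  using ideal_power(2)[OF max_ideal_ideal] unfolding saturation_def by fastforce

lemma (in local_ring) zero_divisors_colon:
  assumes "ideal K R" "ideal L R" "\<And>z. z \<in> L \<Longrightarrow> \<not> nonzerodivisor_mod R K z"
  obtains a where "a \<in> carrier R" "a \<notin> K" "L \<subseteq> ideal_colon R K {a}"
  using common_nonzerodivisor[OF assms(1,1,2)] assms(3) by blast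

lemma (in local_ring) zero_ideal_proper: "{\<zero>} \<noteq> carrier R"
  using one_notin_max_ideal additive_subgroup.zero_closed[OF ideal.axioms(1)[OF max_ideal_ideal]]
    one_closed by (metis singletonD)

lemma (in local_ring) regular_mod_appendD:
  "ideal K R \<Longrightarrow> regular_mod R K (xs @ ys) \<Longrightarrow> regular_mod R K xs"
proof (induction xs arbitrary: K)
  case Nil
  then show ?case using regular_mod_proper[of K ys] by simp
next
  case (Cons x xs)
  then show ?case
    using Idl_insert_ideal[OF Cons.prems(1)] by (auto simp: nonzerodivisor_mod_def)
qed

lemma (in cring) regular_sequence_iff_regular_mod:
  "set xs \<subseteq> carrier R \<Longrightarrow> regular_sequence R xs \<longleftrightarrow> regular_mod R {\<zero>} xs"
  using ring_surjection.regular_sequence_image_iff[OF ring_surjection_id, of xs] by simp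

lemma (in cohen_macaulay_local_ring) maximal_regular_sequence:
  obtains xs where "regular_mod R {\<zero>} xs"
    "\<And>n P. prime_chain R n P \<Longrightarrow> n \<le> length xs"
proof -
  obtain xs where xs: "regular_mod R {\<zero>} xs" "depth R = enat (length xs)"
    using ring_surjection.depth_image_attained[OF ring_surjection_id local_ring_axioms zero_ideal_proper]
    by metis
  have "n \<le> length xs" if "prime_chain R n P" for n P
  proof -
    have "enat n \<le> krull_dim R"
      unfolding krull_dim_def using that by (intro Sup_upper) blast
    then show ?thesis using xs(2) depth_eq_dim by simp
  qed
  then show ?thesis using xs(1) that by blast
qed

lemma prime_height_eq_0_iff:
  assumes "primeideal Q A"
  shows "prime_height A Q = 0 \<longleftrightarrow> (\<forall>P. primeideal P A \<longrightarrow> \<not> P \<subset> Q)"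
proof
  assume zero: "prime_height A Q = 0"
  show "\<forall>P. primeideal P A \<longrightarrow> \<not> P \<subset> Q"
  proof (intro allI impI notI)
    fix P assume "primeideal P A" "P \<subset> Q"
    then have "prime_chain A (Suc 0) (case_nat P (\<lambda>_. Q))"
      using assms by (intro prime_chain_Cons) (simp_all add: prime_chain_def)
    then have "enat (Suc 0) \<le> prime_height A Q"
      unfolding prime_height_def by (intro Sup_upper) force
    with zero show False by (simp add: zero_enat_def)
  qed
next
  assume minimal: "\<forall>P. primeideal P A \<longrightarrow> \<not> P \<subset> Q"
  have "n = 0" if "prime_chain A n P" "P n = Q" for n P
  proof (cases n)
    case (Suc k)
    then have "primeideal (P k) A" "P k \<subset> Q"
      using that unfolding prime_chain_def by auto
    then show ?thesis using minimal by blast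
  qed
  then have "prime_height A Q \<le> 0"
    unfolding prime_height_def by (intro Sup_least) (auto simp: zero_enat_def)
  then show "prime_height A Q = 0" by simp
qed

lemma Inf_enat_eq_0_iff:
  fixes H :: "enat set"
  shows "Inf H = 0 \<longleftrightarrow> 0 \<in> H"
proof
  assume zero: "Inf H = 0"
  then have "H \<noteq> {}" by (auto simp: Inf_enat_def)
  then have "Inf H \<in> H"
    unfolding Inf_enat_def by (auto intro: LeastI)
  with zero show "0 \<in> H" by simp
next
  assume "0 \<in> H"
  then have "Inf H \<le> 0" by (rule Inf_lower)
  then show "Inf H = 0" by simp
qed

lemma height_eq_0_iff:
  "height A J = 0 \<longleftrightarrow>
    (\<exists>Q. primeideal Q A \<and> J \<subseteq> Q \<and> (\<forall>P. primeideal P A \<longrightarrow> \<not> P \<subset> Q))"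
proof -
  have "height A J = 0 \<longleftrightarrow> (\<exists>Q. 0 = prime_height A Q \<and> primeideal Q A \<and> J \<subseteq> Q)"
    unfolding height_def Inf_enat_eq_0_iff by simp
  then show ?thesis
    using prime_height_eq_0_iff by metis
qed

text \<open>For a Cohen--Macaulay ring this is unmixedness: with a regular sequence of length \<open>dim R\<close> it
  gives \<open>dim R/J = dim R\<close>. A minimal prime \<open>Q\<close> of \<open>R\<close> above \<open>J\<close> consists of zero divisors, so it lies
  in an associated prime, and the regular sequence produces a chain of its length from there.\<close>

lemma (in local_ring) prime_chain_above_height_0:
  assumes "height R J = 0" "regular_mod R {\<zero>} xs"
  obtains P where "prime_chain R (length xs) P" "J \<subseteq> P 0"
proof -
  obtain Q where Q: "primeideal Q R" "J \<subseteq> Q" "\<And>P. primeideal P R \<Longrightarrow> \<not> P \<subset> Q"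
    using assms(1) unfolding height_eq_0_iff by blast
  have Qid: "ideal Q R" using Q(1) primeideal.axioms(1) by blast
  have "\<not> nonzerodivisor_mod R {\<zero>} x" if "x \<in> Q" for x
  proof
    assume x: "nonzerodivisor_mod R {\<zero>} x"
    have "insert x {\<zero>} \<subseteq> Q"
      using that additive_subgroup.zero_closed[OF ideal.axioms(1)[OF Qid]] by simp
    then obtain P where "primeideal P R" "{\<zero>} \<subseteq> P" "P \<subset> Q"
      by (rule prime_below_nonzerodivisor[OF zeroideal x Q(1)])
    with Q(3) show False by blast
  qed
  then obtain a where a: "a \<in> carrier R" "a \<notin> {\<zero>}" "Q \<subseteq> ideal_colon R {\<zero>} {a}"
    using zero_divisors_colon[OF zeroideal Qid] by blast
  obtain P where P: "P \<in> associated_primes R {\<zero>}" "ideal_colon R {\<zero>} {a} \<subseteq> P"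
    by (rule colon_subset_associated_prime[OF zeroideal a(1,2)])
  obtain C where "prime_chain R (length xs) C" "C 0 = P"
    using regular_mod_prime_chain_above[OF zeroideal assms(2) P(1)] by blast
  then show ?thesis using that Q(2) a(3) P(2) by blast
qed

text \<open>Another prime over the sequence would sit between a chain of the length of \<open>xs\<close> below it and the
  maximal ideal above it, and the resulting chain would be too long.\<close>

lemma (in local_ring) prime_over_long_regular_sequence:
  assumes dim: "\<And>n C. prime_chain R n C \<Longrightarrow> n \<le> length xs"
    and xs: "regular_mod R {\<zero>} xs" and P: "primeideal P R" "set xs \<subseteq> P"
  shows "P = max_ideal R"
proof (rule ccontr)
  assume "P \<noteq> max_ideal R"
  have Pid: "ideal P R" using P(1) primeideal.axioms(1) by blast
  then have "P \<subset> max_ideal R"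
    using proper_ideal_subset_max_ideal[OF Pid] primeideal.I_notcarr[OF P(1)] \<open>P \<noteq> max_ideal R\<close>
    by blast
  moreover have "{\<zero>} \<union> set xs \<subseteq> P"
    using P(2) additive_subgroup.zero_closed[OF ideal.axioms(1)[OF Pid]] by simp
  then obtain C where C: "prime_chain R (length xs) C" "C (length xs) = P"
    using regular_mod_prime_chain_below[OF zeroideal xs P(1)] by blast
  ultimately have "prime_chain R (Suc (length xs)) (C(Suc (length xs) := max_ideal R))"
    by (intro prime_chain_snoc max_ideal_prime) simp_all
  then show False using dim by fastforce
qed

section \<open>Comparison of the saturations\<close>

text \<open>Both sides are the unit ideal. Height zero gives \<open>dim R/J = dim R\<close>, so \<open>t = depth S = dim S\<close>
  equals \<open>dim R\<close>; the ideal \<open>I\<close> of the sequence then contains a power of the maximal ideal of \<open>R\<close>,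
  and its extension a power of that of \<open>S\<close>.\<close>

lemma (in cohen_macaulay_local_ring) saturations_agree_if_cohen_macaulay_quotient:
  fixes J defines "S \<equiv> R Quot J"
  assumes J: "ideal J R" "J \<noteq> carrier R"
    and S: "cohen_macaulay_local_ring S" and height: "height R J = 0"
    and xs: "enat (length xs) = depth S" "regular_mod R {\<zero>} xs"
  shows "ideal_extension ((+>) J) S (saturation R (Idl (set xs))) =
    saturation S (ideal_extension ((+>) J) S (Idl (set xs)))"
proof -
  interpret h: ring_surjection R S "(+>) J" J
    unfolding S_def by (rule ring_surjection_quotient[OF J(1)])
  interpret S: cohen_macaulay_local_ring S by (rule S)
  let ?I = "Idl (set xs)"
  have sub: "set xs \<subseteq> carrier R" by (rule regular_mod_carrier[OF xs(2)])
  have I: "ideal ?I R" "set xs \<subseteq> ?I"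
    using genideal_ideal[OF sub] genideal_self[OF sub] by blast+
  obtain ds where ds: "regular_mod R {\<zero>} ds" "\<And>n P. prime_chain R n P \<Longrightarrow> n \<le> length ds"
    using maximal_regular_sequence by blast
  obtain C where "prime_chain R (length ds) C" "J \<subseteq> C 0"
    by (rule prime_chain_above_height_0[OF height ds(1)])
  then have "enat (length ds) \<le> krull_dim S"
    unfolding h.krull_dim_image by (intro Sup_upper) blast
  then have "length ds \<le> length xs"
    using xs(1) S.depth_eq_dim by (metis enat_ord_simps(1))
  then have only_max: "P = max_ideal R" if "primeideal P R" "?I \<subseteq> P" for P
    using prime_over_long_regular_sequence[OF _ xs(2) that(1)] ds(2) I(2) that(2) order.trans by metis
  have "saturation R ?I = carrier R"
    by (rule saturation_eq_carrier[OF I(1) only_max])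
  then have lhs: "ideal_extension ((+>) J) S (saturation R ?I) = carrier S"
    unfolding ideal_extension_def h.surj by (simp add: h.surj h.S.Idl_of_ideal h.S.oneideal)
  have hI: "(+>) J ` ?I \<subseteq> carrier S"
    using ideal_subset_carrier[OF I(1)] h.surj by blast
  have ext: "ideal (ideal_extension ((+>) J) S ?I) S" "(+>) J ` ?I \<subseteq> ideal_extension ((+>) J) S ?I"
    unfolding ideal_extension_def using h.S.genideal_ideal[OF hI] h.S.genideal_self[OF hI] by blast+
  have "saturation S (ideal_extension ((+>) J) S ?I) = carrier S"
  proof (rule S.saturation_eq_carrier[OF ext(1)])
    fix P assume P: "primeideal P S" "ideal_extension ((+>) J) S ?I \<subseteq> P"
    have "?I \<subseteq> h.preimage P"
      using P(2) ext(2) ideal_subset_carrier[OF I(1)] unfolding h.preimage_def by blast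
    then have "h.preimage P = max_ideal R"
      using only_max h.preimage_prime[OF P(1)] by blast
    then show "P = max_ideal S"
      using h.image_preimage[of P] primeideal.axioms(1)[OF P(1)] h.local_image(2)[OF local_ring_axioms J(2)]
      by simp
  qed
  with lhs show ?thesis by simp
qed

text \<open>If \<open>t = depth S\<close> were smaller than \<open>dim R\<close>, a common regular sequence of length \<open>t\<close>, with
  ideal \<open>I\<close>, would leave a nonzerodivisor in the maximal ideal modulo \<open>I\<close>, making \<open>I\<close> saturated,
  but none modulo \<open>J + I\<close>, so that the saturation of \<open>I S\<close> would be strictly larger than \<open>I S\<close>.\<close>

lemma (in cohen_macaulay_local_ring) depth_quotient_eq_dim_if_saturations_agree:
  fixes J defines "S \<equiv> R Quot J"
  assumes J: "ideal J R" "J \<noteq> carrier R"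
    and sat: "\<And>xs. regular_mod R {\<zero>} xs \<Longrightarrow> regular_mod R J xs \<Longrightarrow> enat (length xs) = depth S \<Longrightarrow>
      ideal_extension ((+>) J) S (saturation R (Idl (set xs))) =
      saturation S (ideal_extension ((+>) J) S (Idl (set xs)))"
  obtains xs where "regular_mod R J xs" "depth S = enat (length xs)"
    "\<And>n P. prime_chain R n P \<Longrightarrow> n \<le> length xs"
proof -
  interpret h: ring_surjection R S "(+>) J" J
    unfolding S_def by (rule ring_surjection_quotient[OF J(1)])
  interpret S: local_ring S
    by (rule h.local_image(1)[OF local_ring_axioms J(2)])
  obtain ts where ts: "regular_mod R J ts" "depth S = enat (length ts)"
      "\<And>ys. regular_mod R J ys \<Longrightarrow> length ys \<le> length ts"
    using h.depth_image_attained[OF local_ring_axioms J(2)] by blast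
  obtain ds where ds: "regular_mod R {\<zero>} ds" "\<And>n P. prime_chain R n P \<Longrightarrow> n \<le> length ds"
    using maximal_regular_sequence by blast
  have "\<not> length ts < length ds"
  proof
    assume less: "length ts < length ds"
    have "regular_mod R {\<zero>} (take (length ts) ds)"
      using regular_mod_appendD[OF zeroideal, of "take (length ts) ds" "drop (length ts) ds"] ds(1)
      by simp
    then obtain xs where xs: "length xs = length ts" "regular_mod R {\<zero>} xs" "regular_mod R J xs"
      using common_regular_sequence[OF zeroideal J(1) _ ts(1)] less by fastforce
    have sub: "set xs \<subseteq> carrier R" by (rule regular_mod_carrier[OF xs(2)])
    define L where "L = Idl (set xs)"
    have L: "ideal L R" "set xs \<subseteq> L"
      unfolding L_def using genideal_ideal[OF sub] genideal_self[OF sub] by blast+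
    have L_eq: "Idl ({\<zero>} \<union> set xs) = L"
    proof
      show "Idl ({\<zero>} \<union> set xs) \<subseteq> L"
        using L additive_subgroup.zero_closed[OF ideal.axioms(1)[OF L(1)]]
        by (intro genideal_minimal) auto
      show "L \<subseteq> Idl ({\<zero>} \<union> set xs)"
        unfolding L_def using sub by (intro subset_Idl_subset) auto
    qed
    obtain n where n: "length ds = length xs + Suc n"
      using less xs(1) less_imp_Suc_add[of "length xs" "length ds"] by auto
    obtain zs where zs: "length zs = Suc n" "regular_mod R L zs"
      using regular_mod_quotient_length[OF zeroideal xs(2) ds(1) n] L_eq by auto
    obtain z zs' where "zs = z # zs'" using zs(1) by (cases zs) auto
    then have z: "z \<in> max_ideal R" "nonzerodivisor_mod R L z"
      using zs(2) regular_mod_max_ideal(3)[OF L(1) zs(2)] by auto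
    have satL: "saturation R L \<subseteq> L"
      by (rule saturation_subset_if_nonzerodivisor[OF z])
    define M where "M = Idl (J \<union> set xs)"
    have JX: "J \<union> set xs \<subseteq> carrier R"
      using ideal_subset_carrier[OF J(1)] sub by simp
    have M: "ideal M R" "J \<union> set xs \<subseteq> M"
      unfolding M_def using genideal_ideal[OF JX] genideal_self[OF JX] by blast+
    have Mproper: "M \<noteq> carrier R"
      unfolding M_def by (rule regular_mod_Idl_proper[OF J(1) xs(3)])
    have LM: "L \<subseteq> M"
      unfolding L_def M_def by (rule subset_Idl_subset[OF JX]) simp
    have "\<not> nonzerodivisor_mod R M w" if w: "w \<in> max_ideal R" for w
    proof
      assume "nonzerodivisor_mod R M w"
      then have "regular_mod R M [w]"
        using Idl_insert_proper[OF M(1) Mproper w] by simp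
      then have "regular_mod R J (xs @ [w])"
        using regular_mod_append[OF J(1) xs(3)] unfolding M_def by simp
      then show False using ts(3)[of "xs @ [w]"] xs(1) by simp
    qed
    then obtain a where a: "a \<in> carrier R" "a \<notin> M" "max_ideal R \<subseteq> ideal_colon R M {a}"
      using zero_divisors_colon[OF M(1) max_ideal_ideal] by blast
    have hL: "(+>) J ` L \<subseteq> carrier S"
      using ideal_subset_carrier[OF L(1)] h.surj by blast
    have ext: "ideal_extension ((+>) J) S L = (+>) J ` M"
    proof -
      have "Idl (J \<union> L) = M"
      proof
        show "Idl (J \<union> L) \<subseteq> M"
          using M LM by (intro genideal_minimal) auto
        show "M \<subseteq> Idl (J \<union> L)"
          unfolding M_def using L(2) ideal_subset_carrier[OF J(1)] ideal_subset_carrier[OF L(1)]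
          by (intro subset_Idl_subset) auto
      qed
      then show ?thesis
        unfolding ideal_extension_def using h.genideal_image[OF ideal_subset_carrier[OF L(1)]] by simp
    qed
    have "J +> a \<in> saturation S ((+>) J ` M)"
    proof -
      have "(J +> a) \<otimes>\<^bsub>S\<^esub> (J +> b) \<in> (+>) J ` M" if "b \<in> max_ideal R" for b
      proof -
        have b: "b \<in> carrier R" using that by (rule max_ideal_carrier)
        have "b \<otimes> a \<in> M"
          using a(3) that by (auto simp: mem_ideal_colon_singleton)
        then have "a \<otimes> b \<in> M"
          using m_comm[OF a(1) b] by simp
        then show ?thesis
          using h.hom_mult[OF a(1) b] by (metis imageI)
      qed
      then have "J +> a \<in> ideal_colon S ((+>) J ` M) (max_ideal S)"
        unfolding ideal_colon_def h.local_image(2)[OF local_ring_axioms J(2)]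
        using h.hom_closed[OF a(1)] by blast
      then show ?thesis using S.socle_subset_saturation by blast
    qed
    also have "saturation S ((+>) J ` M) = ideal_extension ((+>) J) S (saturation R L)"
      using sat[OF xs(2,3)] xs(1) ts(2) ext unfolding L_def by simp
    also have "\<dots> \<subseteq> ideal_extension ((+>) J) S L"
      unfolding ideal_extension_def using satL by (intro h.S.subset_Idl_subset[OF hL] image_mono)
    also have "\<dots> = (+>) J ` M" by (rule ext)
    finally have "a \<in> M"
      using h.image_mem_iff[OF M(1) _ a(1)] M(2) by blast
    with a(2) show False ..
  qed
  then show ?thesis
    using that[OF ts(1,2)] ds(2) by (meson leI order.trans)
qed

text \<open>Once \<open>t = dim R\<close> is known, a prime chain of length \<open>t\<close> above \<open>J\<close>, obtained from the regular
  sequence on \<open>S\<close>, shows \<open>dim S = t\<close>, and its first member has height zero because the chain cannot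
  be prolonged.\<close>

theorem theorem1p2:
  fixes R :: "('a, 'b) ring_scheme" (structure) and J :: "'a set"
  defines "S \<equiv> R Quot J"
  assumes "cohen_macaulay_local_ring R"
    and "ideal J R" and "J \<noteq> carrier R"
  shows "(cohen_macaulay_local_ring S \<and> height R J = 0) \<longleftrightarrow>
    (\<forall>I xs. set xs \<subseteq> carrier R \<and> enat (length xs) = depth S \<and>
        regular_sequence R xs \<and> regular_sequence S (map ((+>) J) xs) \<and> I = Idl (set xs) \<longrightarrow>
      ideal_extension ((+>) J) S (saturation R I) =
      saturation S (ideal_extension ((+>) J) S I))"
proof -
  interpret cohen_macaulay_local_ring R by fact
  note J = \<open>ideal J R\<close> \<open>J \<noteq> carrier R\<close>
  interpret h: ring_surjection R S "(+>) J" J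
    unfolding S_def by (rule ring_surjection_quotient[OF J(1)])
  show ?thesis
  proof (intro iffI allI impI)
    fix I xs
    assume "cohen_macaulay_local_ring S \<and> height R J = 0"
      and xs: "set xs \<subseteq> carrier R \<and> enat (length xs) = depth S \<and> regular_sequence R xs \<and>
        regular_sequence S (map ((+>) J) xs) \<and> I = Idl (set xs)"
    then show "ideal_extension ((+>) J) S (saturation R I) =
        saturation S (ideal_extension ((+>) J) S I)"
      using saturations_agree_if_cohen_macaulay_quotient[OF J] regular_sequence_iff_regular_mod
      unfolding S_def by blast
  next
    assume sat: "\<forall>I xs. set xs \<subseteq> carrier R \<and> enat (length xs) = depth S \<and>
        regular_sequence R xs \<and> regular_sequence S (map ((+>) J) xs) \<and> I = Idl (set xs) \<longrightarrow>
      ideal_extension ((+>) J) S (saturation R I) =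
      saturation S (ideal_extension ((+>) J) S I)"
    have sat': "ideal_extension ((+>) J) S (saturation R (Idl (set xs))) =
        saturation S (ideal_extension ((+>) J) S (Idl (set xs)))"
      if "regular_mod R {\<zero>} xs" "regular_mod R J xs" "enat (length xs) = depth S" for xs
      using sat regular_mod_carrier[OF that(1)] that
        regular_sequence_iff_regular_mod[of xs] h.regular_sequence_image_iff[of xs] by blast
    obtain xs where xs: "regular_mod R J xs" "depth S = enat (length xs)"
        "\<And>n P. prime_chain R n P \<Longrightarrow> n \<le> length xs"
      using depth_quotient_eq_dim_if_saturations_agree[OF J] sat' unfolding S_def by blast
    have "J \<union> set xs \<subseteq> max_ideal R"
      using regular_mod_max_ideal(2,3)[OF J(1) xs(1)] by simp
    then obtain C where C: "prime_chain R (length xs) C" "J \<subseteq> C 0"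
      using regular_mod_prime_chain_below[OF J(1) xs(1) max_ideal_prime] by blast
    have "krull_dim S = enat (length xs)"
      unfolding h.krull_dim_image
    proof (rule antisym)
      show "Sup {enat n | n. \<exists>P. prime_chain R n P \<and> J \<subseteq> P 0} \<le> enat (length xs)"
        using xs(3) by (intro Sup_least) auto
      show "enat (length xs) \<le> Sup {enat n | n. \<exists>P. prime_chain R n P \<and> J \<subseteq> P 0}"
        using C by (intro Sup_upper) blast
    qed
    then have "cohen_macaulay_local_ring S"
      using h.local_image(1)[OF local_ring_axioms J(2)] xs(2)
      by (simp add: cohen_macaulay_local_ring_def cohen_macaulay_local_ring_axioms_def)
    moreover have "\<not> P \<subset> C 0" if "primeideal P R" for P
      using prime_chain_Cons[OF that C(1)] xs(3) not_less_eq_eq by blast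
    then have "height R J = 0"
      unfolding height_eq_0_iff using C unfolding prime_chain_def by blast
    ultimately show "cohen_macaulay_local_ring S \<and> height R J = 0" by blast
  qed
qed

end
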